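(* Let $\gamma>0$, $\kappa>0$, $\nu^1,\dots,\nu^N\in\mathbb R$. Suppose there exists a constant $D>0$ such that the initial data $(\Theta_0,\Omega_0)$ and the system parameters satisfy $$0<\nu^c-2\kappa\le\gamma\omega^c_0\le\nu^c+2\kappa,\qquad 2\pi R\,\alpha_D<\gamma D,\qquad \mathcal D(\Theta_0)<D,\qquad \mathcal D(\Omega_0+\gamma\Theta_0)\le 2\pi L\,\alpha_D,$$ where $\alpha_D,L,R$ are the constants defined in the context, and let $(\Theta_t,\Omega_t)_{t\ge 0}$ be a global smooth solution of the second-order Winfree model with inertia $$\frac{d}{dt}\theta^i_t=\omega^i_t,\qquad \frac{d}{dt}\omega^i_t=-\gamma\omega^i_t+\nu^i-\frac{\kappa}{N}\sin\theta^i_t\sum_{j=1}^N(1+\cos\theta^j_t),\qquad i=1,\dots,N,$$ with initial data $(\Theta_0,\Omega_0)$. Then $\mathcal D(\Theta_t)$ is uniformly bounded: $$\sup_{t\ge0}\mathcal D(\Theta_t)\le D.$$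
   Context: Notation: $N\ge1$ is the number of oscillators, $\Theta_t=(\theta^1_t,\dots,\theta^N_t)$, $\Omega_t=(\omega^1_t,\dots,\omega^N_t)$, $\nu=(\nu^1,\dots,\nu^N)$, $\omega^c_t=\frac1N\sum_i\omega^i_t$, $\nu^c=\frac1N\sum_i\nu^i$. For ${\bf x}=(x^1,\dots,x^N)\in\mathbb R^N$, $\mathcal D({\bf x})=\max_{1\le i,j\le N}|x^i-x^j|$. Constants: $$m_0=\max\Big\{\mathcal D(\Omega_0),\ \frac{\mathcal D(\nu)+2\kappa D}{\gamma}\Big\},$$ $$\alpha_D=\frac{\gamma\mathcal D(\nu)+2\kappa m_0+3\gamma\kappa D^2}{\nu^c}+\frac{2\gamma^2\kappa\mathcal D(\nu)+8\gamma\kappa^2m_0+6\gamma^2\kappa^2D^2+4\gamma^2\kappa^2D}{\nu^c(\nu^c-2\kappa)},$$ $$L=\frac{\exp\big(-\frac{(4+\pi)\kappa}{2\nu^c}\big)}{1-\exp\big(-\frac{\kappa\pi}{\nu^c}\big)},\qquad R=\frac{\exp\big(\frac{(4-\pi)\kappa}{2\nu^c}\big)}{1-\exp\big(-\frac{\kappa\pi}{\nu^c}\big)}.$$ *)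

theory Defs
  imports "HOL-Analysis.Analysis"
begin

text \<open>The oscillators are indexed by a finite type \<open>'n\<close>, so the number \<open>N = CARD('n) \<ge> 1\<close> is arbitrary.\<close>

definition mean :: "real ^ 'n \<Rightarrow> real" where
  "mean x = (\<Sum>i\<in>UNIV. x $ i) / real CARD('n)"

definition spread :: "real ^ 'n \<Rightarrow> real" where
  "spread x = Max {\<bar>x $ i - x $ j\<bar> | i j. True}"

text \<open>\<open>C\<^sup>\<infinity>\<close> on a set of times, with derivatives relative to the set
  (hence one-sided at the endpoint \<open>0\<close> of \<open>{0..}\<close>); \<open>F k\<close> is the \<open>k\<close>-th derivative of \<open>f\<close>.\<close>

definition smooth_on :: "real set \<Rightarrow> (real \<Rightarrow> 'a::real_normed_vector) \<Rightarrow> bool" where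
  "smooth_on S f \<longleftrightarrow>
    (\<exists>F. F 0 = f \<and>
      (\<forall>k. \<forall>t\<in>S. (F k has_vector_derivative F (Suc k) t) (at t within S)))"

definition winfree_inertia_solution ::
    "real \<Rightarrow> real \<Rightarrow> real ^ 'n \<Rightarrow> (real \<Rightarrow> real ^ 'n) \<Rightarrow> (real \<Rightarrow> real ^ 'n) \<Rightarrow> bool" where
  "winfree_inertia_solution \<gamma> \<kappa> \<nu> \<Theta> \<Omega> \<longleftrightarrow>
    smooth_on {0..} \<Theta> \<and> smooth_on {0..} \<Omega> \<and>
    (\<forall>t\<ge>0. \<forall>i.
      ((\<lambda>s. \<Theta> s $ i) has_real_derivative \<Omega> t $ i) (at t within {0..}) \<and>
      ((\<lambda>s. \<Omega> s $ i) has_real_derivative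
        (- \<gamma> * \<Omega> t $ i + \<nu> $ i
          - \<kappa> / real CARD('n) * sin (\<Theta> t $ i) * (\<Sum>j\<in>UNIV. 1 + cos (\<Theta> t $ j))))
        (at t within {0..}))"

definition m\<^sub>0 :: "real \<Rightarrow> real \<Rightarrow> real ^ 'n \<Rightarrow> real ^ 'n \<Rightarrow> real \<Rightarrow> real" where
  "m\<^sub>0 \<gamma> \<kappa> \<nu> \<Omega>\<^sub>0 D = max (spread \<Omega>\<^sub>0) ((spread \<nu> + 2 * \<kappa> * D) / \<gamma>)"

definition alpha :: "real \<Rightarrow> real \<Rightarrow> real ^ 'n \<Rightarrow> real ^ 'n \<Rightarrow> real \<Rightarrow> real" where
  "alpha \<gamma> \<kappa> \<nu> \<Omega>\<^sub>0 D =
    (\<gamma> * spread \<nu> + 2 * \<kappa> * m\<^sub>0 \<gamma> \<kappa> \<nu> \<Omega>\<^sub>0 D + 3 * \<gamma> * \<kappa> * D\<^sup>2) / mean \<nu>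
    + (2 * \<gamma>\<^sup>2 * \<kappa> * spread \<nu> + 8 * \<gamma> * \<kappa>\<^sup>2 * m\<^sub>0 \<gamma> \<kappa> \<nu> \<Omega>\<^sub>0 D
        + 6 * \<gamma>\<^sup>2 * \<kappa>\<^sup>2 * D\<^sup>2 + 4 * \<gamma>\<^sup>2 * \<kappa>\<^sup>2 * D)
      / (mean \<nu> * (mean \<nu> - 2 * \<kappa>))"

definition L_const :: "real \<Rightarrow> real ^ 'n \<Rightarrow> real" where
  "L_const \<kappa> \<nu> =
    exp (- ((4 + pi) * \<kappa> / (2 * mean \<nu>))) / (1 - exp (- (\<kappa> * pi / mean \<nu>)))"

definition R_const :: "real \<Rightarrow> real ^ 'n \<Rightarrow> real" where
  "R_const \<kappa> \<nu> =
    exp ((4 - pi) * \<kappa> / (2 * mean \<nu>)) / (1 - exp (- (\<kappa> * pi / mean \<nu>)))"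

end

theory Submission
  imports Defs
begin

text \<open>
  Put \<open>p = (\<omega>\<^sup>i - \<omega>\<^sup>j) / \<gamma> + (\<theta>\<^sup>i - \<theta>\<^sup>j)\<close> and \<open>k = \<kappa> / \<nu>\<^sup>c < 1/2\<close>. Since
  \<open>(\<theta>\<^sup>i - \<theta>\<^sup>j)' = \<gamma> (p - (\<theta>\<^sup>i - \<theta>\<^sup>j))\<close>, a bound \<open>p \<le> K < D\<close> keeps the phase differences
  below \<open>D\<close>. As long as they are, \<open>p\<close> obeys up to \<open>O(D\<^sup>2)\<close> the scalar equation
  \<open>(\<gamma> / \<kappa>) p' = (\<nu>\<^sup>i - \<nu>\<^sup>j) / \<kappa> - c(\<theta>\<^sup>c) (\<theta>\<^sup>i - \<theta>\<^sup>j)\<close> with \<open>c = cos + cos\<^sup>2\<close>, and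
  \<open>\<theta>\<^sup>c\<close> is within \<open>2 \<kappa> / \<gamma>\<^sup>2\<close> of the slow phase \<open>\<theta>\<^sup>c + (\<omega>\<^sup>c - \<nu>\<^sup>c / \<gamma>) / \<gamma>\<close>, whose
  velocity is always positive. The proof compares \<open>p\<close> with a \<open>2\<pi>\<close>-periodic barrier \<open>Q\<close> of the slow
  phase that grows strictly faster than \<open>p\<close> wherever the two meet; so \<open>p\<close>, which starts below
  \<open>Q\<close>, stays below it. In units of \<open>a = \<alpha>\<^sub>D \<nu>\<^sup>c / (\<kappa> \<gamma>)\<close> the barrier ranges over
  \<open>[2 - 4 k + 4 k\<^sup>2, 2 + 4 k + 3 k\<^sup>2]\<close>, which lies between \<open>2 \<pi> k L\<close> and \<open>2 \<pi> k R\<close>.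

  \<open>Q\<close> is explicit: quadratic in \<open>k\<close>, modelled on the expansion of a periodic solution of the comparison
  equation, with rational trigonometric polynomials as coefficients. The required differential
  inequalities then reduce to the nonnegativity of finitely many trigonometric polynomials with
  integer coefficients.
\<close>

section \<open>Nonnegativity of trigonometric polynomials\<close>

text \<open>The list \<open>[a\<^sub>0, \<dots>, a\<^sub>n]\<close> stands for the binary form \<open>\<Sum>i\<le>n. a\<^sub>i p\<^sup>i q\<^bsup>n-i\<^esup>\<close>.\<close>

fun form_eval :: "int list \<Rightarrow> real \<Rightarrow> real \<Rightarrow> real" where
  "form_eval [] p q = 0"
| "form_eval (a # as) p q = of_int a * q ^ length as + p * form_eval as p q"

fun form_add :: "int list \<Rightarrow> int list \<Rightarrow> int list" where
  "form_add (a # as) (b # bs) = (a + b) # form_add as bs"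
| "form_add [] bs = []"
| "form_add (a # as) [] = []"

text \<open>Since \<open>form_add\<close> truncates to the shorter list, the singleton case and the
  padding by zeros keep both summands at the length that the degree of the product requires.\<close>

fun form_mult :: "int list \<Rightarrow> int list \<Rightarrow> int list" where
  "form_mult [] bs = []"
| "form_mult [a] bs = map ((*) a) bs"
| "form_mult (a # a' # as) bs =
     form_add (map ((*) a) bs @ replicate (length (a' # as)) 0) (0 # form_mult (a' # as) bs)"

text \<open>A Horner step for substituting \<open>p + q\<close> for \<open>p\<close>: appending
  \<open>0\<close> multiplies a form by \<open>q\<close>; prepending \<open>a\<close> multiplies it
  by \<open>p\<close> and adds \<open>a\<close> times a power of \<open>q\<close>.\<close>

definition form_shift_step :: "int \<Rightarrow> int list \<Rightarrow> int list" where
  "form_shift_step a bs = form_add (bs @ [0]) (a # bs)"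

fun form_shift :: "int list \<Rightarrow> int list" where
  "form_shift [] = []"
| "form_shift (a # as) = form_shift_step a (form_shift as)"

text \<open>The quadrant \<open>p, q \<ge> 0\<close> is bisected along \<open>p = q\<close>; each half is mapped back onto the quadrant
  by \<open>(p, q) \<mapsto> (p + q, q)\<close> or \<open>(q, p + q)\<close>. A form with nonnegative coefficients needs no further
  bisection.\<close>

fun form_nonneg :: "nat \<Rightarrow> int list \<Rightarrow> bool" where
  "form_nonneg 0 as \<longleftrightarrow> list_all ((\<le>) 0) as"
| "form_nonneg (Suc n) as \<longleftrightarrow> list_all ((\<le>) 0) as \<or>
     (form_nonneg n (form_shift as) \<and> form_nonneg n (form_shift (rev as)))"

lemma length_form_add [simp]: "length (form_add as bs) = min (length as) (length bs)"
  by (induction as bs rule: form_add.induct) auto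

lemma length_form_mult [simp]:
  "as \<noteq> [] \<Longrightarrow> bs \<noteq> [] \<Longrightarrow> length (form_mult as bs) = length as + length bs - 1"
  by (induction as bs rule: form_mult.induct) auto

lemma length_form_shift [simp]: "length (form_shift as) = length as"
  by (induction as) (auto simp: form_shift_step_def)

lemma form_eval_add:
  "length as = length bs \<Longrightarrow> form_eval (form_add as bs) p q = form_eval as p q + form_eval bs p q"
  by (induction as bs rule: form_add.induct) (auto simp: algebra_simps)

lemma form_eval_map_mult: "form_eval (map ((*) c) as) p q = of_int c * form_eval as p q"
  by (induction as) (auto simp: algebra_simps)

lemma form_eval_append:
  "form_eval (as @ bs) p q = form_eval as p q * q ^ length bs + p ^ length as * form_eval bs p q"
  by (induction as) (auto simp: algebra_simps power_add)

lemma form_eval_replicate_0: "form_eval (replicate n 0) p q = 0"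
  by (induction n) auto

lemma form_eval_mult:
  "as \<noteq> [] \<Longrightarrow> bs \<noteq> [] \<Longrightarrow> form_eval (form_mult as bs) p q = form_eval as p q * form_eval bs p q"
  by (induction as bs rule: form_mult.induct)
    (auto simp: form_eval_add form_eval_map_mult form_eval_append form_eval_replicate_0 algebra_simps)

lemma form_eval_shift: "form_eval (form_shift as) p q = form_eval as (p + q) q"
proof (induction as)
  case (Cons a as)
  then show ?case
    by (simp add: form_shift_step_def form_eval_add form_eval_append algebra_simps)
qed simp

lemma form_eval_rev: "form_eval (rev as) p q = form_eval as q p"
  by (induction as) (auto simp: form_eval_append algebra_simps)

lemma form_eval_nonneg_coeffs:
  "list_all ((\<le>) 0) as \<Longrightarrow> 0 \<le> p \<Longrightarrow> 0 \<le> q \<Longrightarrow> 0 \<le> form_eval as p q"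
  by (induction as) auto

lemma form_eval_nonneg:
  "form_nonneg n as \<Longrightarrow> 0 \<le> p \<Longrightarrow> 0 \<le> q \<Longrightarrow> 0 \<le> form_eval as p q"
proof (induction n arbitrary: as p q)
  case 0
  then show ?case by (simp add: form_eval_nonneg_coeffs)
next
  case (Suc n)
  show ?case
  proof (cases "list_all ((\<le>) 0) as")
    case True
    with Suc.prems show ?thesis by (simp add: form_eval_nonneg_coeffs)
  next
    case False
    show ?thesis
    proof (cases "q \<le> p")
      case True
      with Suc.IH[of "form_shift as" "p - q" q] Suc.prems False show ?thesis
        by (simp add: form_eval_shift)
    next
      case f: False
      with Suc.IH[of "form_shift (rev as)" "q - p" p] Suc.prems False show ?thesis
        by (simp add: form_eval_shift form_eval_rev)
    qed
  qed
qed

section \<open>Trigonometric polynomials as syntax, and their half-angle forms\<close>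

datatype trig = Const int | Cos | Sin
  | Plus trig trig (infixl "\<oplus>" 65) | Times trig trig (infixl "\<otimes>" 70)

primrec trig_eval :: "trig \<Rightarrow> real \<Rightarrow> real" where
  "trig_eval (Const a) \<theta> = of_int a"
| "trig_eval Cos \<theta> = cos \<theta>"
| "trig_eval Sin \<theta> = sin \<theta>"
| "trig_eval (s \<oplus> t) \<theta> = trig_eval s \<theta> + trig_eval t \<theta>"
| "trig_eval (s \<otimes> t) \<theta> = trig_eval s \<theta> * trig_eval t \<theta>"

primrec trig_deriv :: "trig \<Rightarrow> trig" where
  "trig_deriv (Const a) = Const 0"
| "trig_deriv Cos = Const (-1) \<otimes> Sin"
| "trig_deriv Sin = Cos"
| "trig_deriv (s \<oplus> t) = trig_deriv s \<oplus> trig_deriv t"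
| "trig_deriv (s \<otimes> t) = trig_deriv s \<otimes> t \<oplus> s \<otimes> trig_deriv t"

lemma has_real_derivative_trig_eval:
  "(trig_eval t has_real_derivative trig_eval (trig_deriv t) \<theta>) (at \<theta>)"
proof -
  have "((\<lambda>\<theta>. trig_eval t \<theta>) has_real_derivative trig_eval (trig_deriv t) \<theta>) (at \<theta>)"
    by (induction t) (auto intro!: derivative_eq_intros)
  then show ?thesis by simp
qed

lemma DERIV_trig_eval [derivative_intros]:
  "(g has_real_derivative g') (at x within S) \<Longrightarrow>
    ((\<lambda>x. trig_eval t (g x)) has_real_derivative trig_eval (trig_deriv t) (g x) * g') (at x within S)"
  by (rule DERIV_chain2[OF has_real_derivative_trig_eval])

text \<open>Multiplication by \<open>p\<^sup>2 + q\<^sup>2 = 1\<close> brings two forms to the same degree.\<close>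

definition form_pad :: "nat \<Rightarrow> int list \<Rightarrow> int list" where
  "form_pad n as = (form_mult [1, 0, 1] ^^ ((n - length as) div 2)) as"

definition form_plus :: "int list \<Rightarrow> int list \<Rightarrow> int list" where
  "form_plus as bs = form_add (form_pad (length bs) as) (form_pad (length as) bs)"

text \<open>The half-angle substitution \<open>p = \<bar>cos (\<theta>/2)\<bar>\<close>, \<open>q = \<bar>sin (\<theta>/2)\<bar>\<close>, where \<open>e = 1\<close> or
  \<open>e = -1\<close> is the sign of \<open>sin \<theta>\<close>.\<close>

primrec trig_form :: "int \<Rightarrow> trig \<Rightarrow> int list" where
  "trig_form e (Const a) = [a]"
| "trig_form e Cos = [-1, 0, 1]"
| "trig_form e Sin = [0, 2 * e, 0]"
| "trig_form e (s \<oplus> t) = form_plus (trig_form e s) (trig_form e t)"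
| "trig_form e (s \<otimes> t) = form_mult (trig_form e s) (trig_form e t)"

text \<open>\<open>8\<close> bounds the depth of bisection; failure at that depth leaves the sign
  undecided.\<close>

definition trig_nonneg :: "trig \<Rightarrow> bool" where
  "trig_nonneg t \<longleftrightarrow> form_nonneg 8 (trig_form 1 t) \<and> form_nonneg 8 (trig_form (-1) t)"

lemma form_mult_neq_Nil: 
  assumes "as \<noteq> []" "bs \<noteq> []"
  shows "form_mult as bs \<noteq> []"
proof -
  have "length (form_mult as bs) \<noteq> 0"
    using assms by (cases as; cases bs) (simp_all del: form_mult.simps)
  then show ?thesis by simp
qed

lemma form_pow_pad:
  assumes "as \<noteq> []"
  shows "(form_mult [1, 0, 1] ^^ n) as \<noteq> []"
    and "length ((form_mult [1, 0, 1] ^^ n) as) = length as + 2 * n"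
    and "p\<^sup>2 + q\<^sup>2 = 1 \<Longrightarrow> form_eval ((form_mult [1, 0, 1] ^^ n) as) p q = form_eval as p q"
proof (induction n)
  case (Suc n)
  { case 1 show ?case using Suc by (simp add: form_mult_neq_Nil del: form_mult.simps) }
  { case 2 show ?case using Suc by (simp del: form_mult.simps) }
  { case 3 then show ?case using Suc
      by (simp add: form_eval_mult power2_eq_square algebra_simps del: form_mult.simps) }
qed (use assms in auto)

text \<open>Cosine and sine are quadratic in the half-angle functions, so all forms have even
  degree. Two lengths thus differ by an even number, and \<open>form_pad\<close> equalises them
  exactly.\<close>

lemma odd_length_trig_form: "odd (length (trig_form e t))"
proof (induction t)
  case (Plus s t)
  then have "trig_form e s \<noteq> []" "trig_form e t \<noteq> []" by auto
  with Plus show ?case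
    by (auto simp: form_plus_def form_pad_def form_pow_pad(2) min_def)
next
  case (Times s t)
  then have "trig_form e s \<noteq> []" "trig_form e t \<noteq> []" by auto
  with Times show ?case by auto
qed auto

lemma form_eval_trig_form:
  assumes "p\<^sup>2 + q\<^sup>2 = 1" "cos \<theta> = p\<^sup>2 - q\<^sup>2" "sin \<theta> = 2 * of_int e * p * q"
  shows "form_eval (trig_form e t) p q = trig_eval t \<theta>"
proof (induction t)
  case (Plus s t)
  note l = odd_length_trig_form[of e s] odd_length_trig_form[of e t]
  then have ne: "trig_form e s \<noteq> []" "trig_form e t \<noteq> []" by auto
  have "length (form_pad (length (trig_form e t)) (trig_form e s)) =
        length (form_pad (length (trig_form e s)) (trig_form e t))"
    using ne l unfolding form_pad_def
    by (cases "length (trig_form e s) \<le> length (trig_form e t)")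
      (auto simp: form_pow_pad(2) elim!: oddE)
  with Plus ne assms(1) show ?case
    by (simp add: form_plus_def form_eval_add) (simp add: form_pad_def form_pow_pad(3))
next
  case (Times s t)
  note l = odd_length_trig_form[of e s] odd_length_trig_form[of e t]
  then have ne: "trig_form e s \<noteq> []" "trig_form e t \<noteq> []" by auto
  with Times show ?case by (simp add: form_eval_mult)
qed (use assms in \<open>auto simp: power2_eq_square algebra_simps\<close>)

lemma trig_eval_nonneg:
  assumes "trig_nonneg t"
  shows "0 \<le> trig_eval t \<theta>"
proof -
  define p q where "p = \<bar>cos (\<theta> / 2)\<bar>" and "q = \<bar>sin (\<theta> / 2)\<bar>"
  have pq: "0 \<le> p" "0 \<le> q" "p\<^sup>2 + q\<^sup>2 = 1" by (auto simp: p_def q_def)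
  have c: "cos \<theta> = p\<^sup>2 - q\<^sup>2"
    using cos_double[of "\<theta> / 2"] by (simp add: p_def q_def)
  have "sin \<theta> = 2 * of_int 1 * p * q \<or> sin \<theta> = 2 * of_int (-1) * p * q"
    using sin_double[of "\<theta> / 2"] by (auto simp: p_def q_def abs_if)
  then show ?thesis
    using assms form_eval_nonneg[of 8 _ p q] form_eval_trig_form[OF pq(3) c] pq
    unfolding trig_nonneg_def by metis
qed

section \<open>Taylor estimates\<close>

lemma trig_taylor_2:
  assumes "\<And>x. \<bar>trig_eval (trig_deriv (trig_deriv t)) x\<bar> \<le> B"
  shows "\<bar>trig_eval t y - trig_eval t x - trig_eval (trig_deriv t) x * (y - x)\<bar> \<le> B / 2 * (y - x)\<^sup>2"
proof -
  define diff where "diff m z = trig_eval ((trig_deriv ^^ m) t) (x + z)" for m z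
  have d: "(diff m has_real_derivative diff (Suc m) z) (at z)" for m z
    unfolding diff_def by (auto intro!: derivative_eq_intros)
  have e: "diff 0 (y - x) = trig_eval t y" by (simp add: diff_def)
  obtain s where s: "trig_eval t y = (\<Sum>m<2. diff m 0 / fact m * (y - x) ^ m) + diff 2 s / fact 2 * (y - x) ^ 2"
    using Maclaurin_all_le[of diff "diff 0" "y - x" 2] d unfolding e by blast
  have remainder: "trig_eval t y - trig_eval t x - trig_eval (trig_deriv t) x * (y - x) =
      trig_eval (trig_deriv (trig_deriv t)) (x + s) / 2 * (y - x)\<^sup>2"
    unfolding s by (simp add: diff_def numeral_2_eq_2)
  show ?thesis
    unfolding remainder using mult_right_mono[OF assms[of "x + s"], of "(y - x)\<^sup>2 / 2"]
    by (simp add: abs_mult)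
qed

text \<open>The first two derivatives stay at \<open>x\<close> instead of being bounded uniformly,
  because \<open>leading_order_m\<close> absorbs them pointwise.\<close>

lemma trig_taylor_3:
  assumes "\<And>x. \<bar>trig_eval (trig_deriv (trig_deriv (trig_deriv t))) x\<bar> \<le> B" "\<bar>y - x\<bar> \<le> h"
  shows "\<bar>trig_eval t y - trig_eval t x\<bar> \<le>
    h * \<bar>trig_eval (trig_deriv t) x\<bar> + h\<^sup>2 / 2 * \<bar>trig_eval (trig_deriv (trig_deriv t)) x\<bar> + B / 6 * h ^ 3"
proof -
  define diff where "diff m z = trig_eval ((trig_deriv ^^ m) t) (x + z)" for m z
  have d: "(diff m has_real_derivative diff (Suc m) z) (at z)" for m z
    unfolding diff_def by (auto intro!: derivative_eq_intros)
  have h: "0 \<le> h" using assms(2) by linarith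
  have e: "diff 0 (y - x) = trig_eval t y" by (simp add: diff_def)
  obtain s where s: "trig_eval t y = (\<Sum>m<3. diff m 0 / fact m * (y - x) ^ m) + diff 3 s / fact 3 * (y - x) ^ 3"
    using Maclaurin_all_le[of diff "diff 0" "y - x" 3] d unfolding e by blast
  have "trig_eval t y - trig_eval t x =
      trig_eval (trig_deriv t) x * (y - x) + trig_eval (trig_deriv (trig_deriv t)) x * (y - x)\<^sup>2 / 2
      + trig_eval (trig_deriv (trig_deriv (trig_deriv t))) (x + s) / 6 * (y - x) ^ 3"
    unfolding s by (simp add: diff_def numeral_2_eq_2 numeral_3_eq_3)
  also have "\<bar>\<dots>\<bar> \<le> \<bar>trig_eval (trig_deriv t) x\<bar> * \<bar>y - x\<bar>
      + \<bar>trig_eval (trig_deriv (trig_deriv t)) x\<bar> * (y - x)\<^sup>2 / 2 + B / 6 * \<bar>y - x\<bar> ^ 3"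
  proof -
    have third: "\<bar>trig_eval (trig_deriv (trig_deriv (trig_deriv t))) (x + s) / 6 * (y - x) ^ 3\<bar> \<le> B / 6 * \<bar>y - x\<bar> ^ 3"
      using mult_right_mono[OF assms(1)[of "x + s"], of "\<bar>y - x\<bar> ^ 3 / 6"]
      by (simp add: abs_mult power_abs)
    have tri: "\<bar>a + b + c\<bar> \<le> \<bar>a\<bar> + \<bar>b\<bar> + \<bar>c\<bar>" for a b c :: real
      by linarith
    show ?thesis
      by (rule order_trans[OF tri], intro add_mono third) (simp_all add: abs_mult)
  qed
  also have "\<dots> \<le> \<bar>trig_eval (trig_deriv t) x\<bar> * h
      + \<bar>trig_eval (trig_deriv (trig_deriv t)) x\<bar> * h\<^sup>2 / 2 + B / 6 * h ^ 3"
  proof (intro add_mono mult_left_mono divide_right_mono)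
    show "(y - x)\<^sup>2 \<le> h\<^sup>2" using assms(2) h by (simp add: abs_le_square_iff[symmetric])
    show "\<bar>y - x\<bar> ^ 3 \<le> h ^ 3" using assms(2) by (simp add: power_mono)
    show "0 \<le> B / 6" using assms(1)[of x] by linarith
  qed (use assms(2) in auto)
  finally show ?thesis by (simp add: mult.commute)
qed

section \<open>The barrier\<close>

text \<open>At a common phase the mean-field factor is \<open>1 + cos\<close>. \<open>drift\<close>
  is then the force \<open>sin (1 + cos)\<close> on the mean, and \<open>coupling\<close> its
  linearisation \<open>cos (1 + cos)\<close> for phase differences, the mean field being
  fixed.\<close>

definition coupling :: trig where "coupling = Cos \<oplus> Cos \<otimes> Cos"
definition drift :: trig where "drift = Sin \<oplus> Sin \<otimes> Cos"

text \<open>The barrier has the form \<open>2 + k (r + k s) / 200\<close>, once for the part of \<open>\<alpha>\<^sub>D\<close> not proportional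
  to \<open>m\<^sub>0\<close> (\<open>rd\<close>, \<open>sd\<close>) and once for the part \<open>2 \<kappa> m\<^sub>0 / \<nu>\<^sup>c\<close> (\<open>rm\<close>, \<open>sm\<close>). The polynomial \<open>rd\<close>
  solves \<open>rd' / 200 + 2 c = 1\<close>, with \<open>c\<close> the coupling; the other coefficients were found by linear
  programming.\<close>

definition rd :: trig where
  "rd = Const 350 \<oplus> Const (-400) \<otimes> Sin \<oplus> Const (-200) \<otimes> Sin \<otimes> Cos"
definition sd :: trig where
  "sd = Const 350 \<oplus> Const (-230) \<otimes> Cos \<oplus> Const (-100) \<otimes> Cos \<otimes> Cos
     \<oplus> Const (-270) \<otimes> Sin \<oplus> Const (-240) \<otimes> Sin \<otimes> Cos"
definition rm :: trig where
  "rm = Const 520 \<oplus> Const (-225) \<otimes> Sin \<oplus> Const (-166) \<otimes> Sin \<otimes> Cos"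
definition sm :: trig where
  "sm = Const 230 \<oplus> Const (-210) \<otimes> Cos \<oplus> Const (-100) \<otimes> Cos \<otimes> Cos
     \<oplus> Const (-330) \<otimes> Sin \<oplus> Const (-290) \<otimes> Sin \<otimes> Cos"

text \<open>The first- and second-order coefficients in \<open>k\<close> of the comparison operator, see
  \<open>barrier_operator\<close>.\<close>

definition lin :: "trig \<Rightarrow> trig \<Rightarrow> trig" where
  "lin r s = Const (-1) \<otimes> drift \<otimes> trig_deriv r \<oplus> coupling \<otimes> r \<oplus> trig_deriv s"
definition quad :: "trig \<Rightarrow> trig" where
  "quad s = Const (-1) \<otimes> drift \<otimes> trig_deriv s \<oplus> coupling \<otimes> s"

text \<open>An affine function of \<open>k\<close> is nonnegative on \<open>[0, 1/2]\<close> if it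
  is so at both ends: the entries are its value at \<open>0\<close> and twice its value at
  \<open>1/2\<close>.\<close>

lemma barrier_d_certificate: "list_all trig_nonneg [lin rd sd, Const 2 \<otimes> lin rd sd \<oplus> quad sd]"
  by code_simp

text \<open>Consecutive pairs test an affine function of \<open>k\<close> at \<open>0\<close> and,
  doubled, at \<open>1/2\<close>: upper bound, lower bound, and the two signs of the slope bound
  \<open>6 = 1200 / 200\<close>.\<close>

lemma barrier_range_certificate: "\<forall>(r, s) \<in> {(rd, sd), (rm, sm)}. list_all trig_nonneg
   [Const 800 \<oplus> Const (-1) \<otimes> r, Const 2200 \<oplus> Const (-2) \<otimes> r \<oplus> Const (-1) \<otimes> s,
    Const 800 \<oplus> r, Const 800 \<oplus> Const 2 \<otimes> r \<oplus> s,
    Const 1200 \<oplus> Const (-1) \<otimes> trig_deriv r, Const 2400 \<oplus> Const (-2) \<otimes> trig_deriv r \<oplus> Const (-1) \<otimes> trig_deriv s,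
    Const 1200 \<oplus> trig_deriv r, Const 2400 \<oplus> Const 2 \<otimes> trig_deriv r \<oplus> trig_deriv s]"
  by code_simp

text \<open>\<open>leading_order_m\<close> multiplied by 4800, with every choice of signs in place
  of the absolute values; \<open>634 = 4800 (5/96 + 2/25)\<close>.\<close>

lemma leading_order_m_certificate: "\<forall>e1\<in>{1, -1}. \<forall>e2\<in>{1, -1}. \<forall>e3\<in>{1, -1}. trig_nonneg
   (Const 48 \<otimes> (trig_deriv rm \<oplus> Const 400 \<otimes> coupling)
    \<oplus> Const (4800 * e1) \<otimes> coupling
    \<oplus> Const (4800 * e2) \<otimes> trig_deriv coupling
    \<oplus> Const (600 * e3) \<otimes> trig_deriv (trig_deriv coupling) \<oplus> Const (-634))"
  by code_simp

text \<open>\<open>higher_order_m\<close> multiplied by \<open>1600 (2 + 4 k)\<close> is a quadratic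
  in \<open>k\<close> with coefficients \<open>P0\<close>, \<open>P1\<close>, \<open>P2\<close>; the
  list holds the combinations that \<open>quadratic_nonneg\<close> asks for. The signs resolve
  absolute values.\<close>

lemma higher_order_m_certificate: "\<forall>e1\<in>{1, -1}. \<forall>e2\<in>{1, -1}. \<forall>(r, s)\<in>{(rd, sd), (rm, sm)}. 
  let F = Const (8 * e1) \<otimes> trig_deriv drift \<oplus> Const 3;
      P0 = Const 2 \<otimes> (Const 256 \<oplus> Const 16 \<otimes> lin rm sm) \<oplus> Const e2 \<otimes> F \<otimes> trig_deriv r;
      P1 = Const 4 \<otimes> (Const 256 \<oplus> Const 16 \<otimes> lin rm sm) \<oplus> Const 32 \<otimes> quad sm \<oplus> Const e2 \<otimes> F \<otimes> trig_deriv s;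
      P2 = Const 64 \<otimes> quad sm
  in list_all trig_nonneg [P0, Const 4 \<otimes> P0 \<oplus> P1, Const 4 \<otimes> P0 \<oplus> Const 2 \<otimes> P1 \<oplus> P2]"
  by code_simp

lemma derivative_bounds_certificate: "\<forall>e\<in>{1, -1}. trig_nonneg (Const 5 \<oplus> Const e \<otimes> trig_deriv (trig_deriv (trig_deriv coupling)))
   \<and> trig_nonneg (Const 3 \<oplus> Const e \<otimes> trig_deriv (trig_deriv drift))"
  by code_simp

section \<open>Range, slope and growth of the barrier\<close>

definition barrier :: "trig \<Rightarrow> trig \<Rightarrow> real \<Rightarrow> real \<Rightarrow> real" where
  "barrier r s k \<theta> = 2 + k / 200 * (trig_eval r \<theta> + k * trig_eval s \<theta>)"

text \<open>The derivative of the barrier without its factor \<open>k\<close>, which cancels once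
  rates are measured in units of \<open>\<kappa> / \<gamma>\<close>.\<close>

definition slope :: "trig \<Rightarrow> trig \<Rightarrow> real \<Rightarrow> real \<Rightarrow> real" where
  "slope r s k \<theta> = (trig_eval (trig_deriv r) \<theta> + k * trig_eval (trig_deriv s) \<theta>) / 200"

lemma has_real_derivative_barrier:
  "(barrier r s k has_real_derivative k * slope r s k \<theta>) (at \<theta>)"
  unfolding barrier_def[abs_def] slope_def by (auto intro!: derivative_eq_intros)

lemma affine_nonneg:
  fixes k :: real
  assumes "0 \<le> k" "k \<le> 1 / 2" "0 \<le> P0" "0 \<le> 2 * P0 + P1"
  shows "0 \<le> P0 + k * P1"
proof -
  have "0 \<le> (1 - 2 * k) * P0" "0 \<le> k * (2 * P0 + P1)"
    by (rule mult_nonneg_nonneg; use assms in linarith)+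
  then show ?thesis by (simp add: algebra_simps)
qed

text \<open>The last three hypotheses are the coefficients in the basis \<open>(1 - 2 k)^2\<close>,
  \<open>k (1 - 2 k)\<close>, \<open>k^2\<close>, whose members are nonnegative on
  \<open>[0, 1/2]\<close>.\<close>

lemma quadratic_nonneg:
  fixes k :: real
  assumes "0 \<le> k" "k \<le> 1 / 2" "0 \<le> P0" "0 \<le> 4 * P0 + P1" "0 \<le> 4 * P0 + 2 * P1 + P2"
  shows "0 \<le> P0 + k * P1 + k\<^sup>2 * P2"
proof -
  have "0 \<le> (1 - 2 * k)\<^sup>2 * P0" "0 \<le> k * (1 - 2 * k) * (4 * P0 + P1)"
    "0 \<le> k\<^sup>2 * (4 * P0 + 2 * P1 + P2)"
    by (intro mult_nonneg_nonneg zero_le_power2; use assms in linarith)+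
  then show ?thesis by (simp add: algebra_simps power2_eq_square)
qed

lemma barrier_bounds:
  assumes "0 < k" "k \<le> 1 / 2" "(r, s) \<in> {(rd, sd), (rm, sm)}"
  shows "2 - 4 * k + 4 * k\<^sup>2 \<le> barrier r s k \<theta>" "barrier r s k \<theta> \<le> 2 + 4 * k + 3 * k\<^sup>2"
    and "\<bar>slope r s k \<theta>\<bar> \<le> 6"
proof -
  let ?r = "trig_eval r \<theta>" and ?s = "trig_eval s \<theta>"
  let ?r' = "trig_eval (trig_deriv r) \<theta>" and ?s' = "trig_eval (trig_deriv s) \<theta>"
  have *: "0 \<le> 800 - ?r" "0 \<le> 2200 - 2 * ?r - ?s" "0 \<le> 800 + ?r" "0 \<le> 800 + 2 * ?r + ?s"
    "0 \<le> 1200 - ?r'" "0 \<le> 2400 - 2 * ?r' - ?s'" "0 \<le> 1200 + ?r'" "0 \<le> 2400 + 2 * ?r' + ?s'"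
    using bspec[OF barrier_range_certificate assms(3)] trig_eval_nonneg[of _ \<theta>] by (fastforce simp: algebra_simps)+
  have k: "0 \<le> k / 200" "0 \<le> k" using assms by auto
  have "0 \<le> (800 + ?r) + k * (?s - 800)"
    using * assms by (intro affine_nonneg) auto
  from mult_left_mono[OF this k(1)] show "2 - 4 * k + 4 * k\<^sup>2 \<le> barrier r s k \<theta>"
    unfolding barrier_def by (simp add: algebra_simps add_divide_distrib power2_eq_square)
  have "0 \<le> (800 - ?r) + k * (600 - ?s)"
    using * assms by (intro affine_nonneg) auto
  from mult_left_mono[OF this k(1)] show "barrier r s k \<theta> \<le> 2 + 4 * k + 3 * k\<^sup>2"
    unfolding barrier_def by (simp add: algebra_simps add_divide_distrib power2_eq_square)
  have "0 \<le> (1200 - ?r') + k * (- ?s')" "0 \<le> (1200 + ?r') + k * ?s'"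
    using * assms by (intro affine_nonneg; auto)+
  then show "\<bar>slope r s k \<theta>\<bar> \<le> 6"
    unfolding slope_def by (auto simp: abs_le_iff)
qed

text \<open>The slow phase moves at about \<open>(\<nu>^c - \<kappa> drift) / \<gamma>\<close>, so
  the first summand is the growth rate of the barrier in units of
  \<open>\<kappa> / \<gamma>\<close>; the second is the restoring term in the equation for
  \<open>p\<close>.\<close>

lemma barrier_operator:
  "(1 - k * trig_eval drift \<theta>) * slope r s k \<theta> + trig_eval coupling \<theta> * barrier r s k \<theta> =
    (trig_eval (trig_deriv r) \<theta> + 400 * trig_eval coupling \<theta>) / 200
    + k * (trig_eval (lin r s) \<theta> + k * trig_eval (quad s) \<theta>) / 200"
  by (simp add: slope_def barrier_def lin_def quad_def field_simps)

lemma barrier_operator_d: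
  assumes "0 < k" "k \<le> 1 / 2"
  shows "1 \<le> (1 - k * trig_eval drift \<theta>) * slope rd sd k \<theta> + trig_eval coupling \<theta> * barrier rd sd k \<theta>"
proof -
  have "trig_eval (trig_deriv rd) \<theta> + 400 * trig_eval coupling \<theta> = 200"
  proof -
    have "trig_eval (trig_deriv rd) \<theta> + 400 * trig_eval coupling \<theta> =
        200 * (cos \<theta> * cos \<theta> + sin \<theta> * sin \<theta>)"
      by (simp add: rd_def coupling_def algebra_simps del: sin_cos_squared_add3)
    then show ?thesis by simp
  qed
  moreover have "0 \<le> trig_eval (lin rd sd) \<theta> + k * trig_eval (quad sd) \<theta>"
    using assms barrier_d_certificate trig_eval_nonneg[of _ \<theta>] by (intro affine_nonneg) fastforce+
  ultimately show ?thesis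
    using assms unfolding barrier_operator by simp
qed

lemma obtain_sign:
  fixes u :: real
  obtains e :: int where "e \<in> {1, -1}" "\<bar>u\<bar> = of_int e * u"
  by (cases "0 \<le> u") (force intro: that[of 1], force intro: that[of "-1"])

text \<open>A budget per unit of \<open>m\<close>: \<open>coupling\<close> pays for replacing
  \<open>u\<close> by \<open>u + v\<close>, its derivatives pay for a phase shift
  \<open>h \<le> 1/4\<close>, and \<open>2/25\<close> is reserved for terms carrying a factor
  \<open>k\<close>.\<close>

lemma leading_order_m:
  "\<bar>trig_eval coupling \<theta>\<bar> + \<bar>trig_eval (trig_deriv coupling) \<theta>\<bar>
    + \<bar>trig_eval (trig_deriv (trig_deriv coupling)) \<theta>\<bar> / 8 + 5 / 96 + 2 / 25
    \<le> (trig_eval (trig_deriv rm) \<theta> + 400 * trig_eval coupling \<theta>) / 100"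
proof -
  obtain e1 e2 e3 :: int where e: "e1 \<in> {1, -1}" "e2 \<in> {1, -1}" "e3 \<in> {1, -1}"
    "\<bar>trig_eval coupling \<theta>\<bar> = of_int e1 * trig_eval coupling \<theta>"
    "\<bar>trig_eval (trig_deriv coupling) \<theta>\<bar> = of_int e2 * trig_eval (trig_deriv coupling) \<theta>"
    "\<bar>trig_eval (trig_deriv (trig_deriv coupling)) \<theta>\<bar> =
      of_int e3 * trig_eval (trig_deriv (trig_deriv coupling)) \<theta>"
    using obtain_sign by metis
  have "-e1 \<in> {1, -1}" "-e2 \<in> {1, -1}" "-e3 \<in> {1, -1}" using e by auto
  then have "trig_nonneg
   (Const 48 \<otimes> (trig_deriv rm \<oplus> Const 400 \<otimes> coupling)
    \<oplus> Const (4800 * - e1) \<otimes> coupling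
    \<oplus> Const (4800 * - e2) \<otimes> trig_deriv coupling
    \<oplus> Const (600 * - e3) \<otimes> trig_deriv (trig_deriv coupling) \<oplus> Const (-634))"
    using leading_order_m_certificate by blast
  from trig_eval_nonneg[OF this, of \<theta>] show ?thesis
    unfolding e trig_eval.simps by (simp add: algebra_simps)
qed

text \<open>The left side is the cost of shifting the phase in \<open>drift\<close>, where
  \<open>3/8\<close> is the second-order term at \<open>h \<le> 1/4\<close>. After multiplication by
  \<open>k \<le> 1/2\<close> the \<open>4/25\<close> fits the reserve \<open>2/25\<close>.\<close>

lemma higher_order_m:
  assumes "0 < k" "k \<le> 1 / 2" "(r, s) \<in> {(rd, sd), (rm, sm)}"
  shows "(\<bar>trig_eval (trig_deriv drift) \<theta>\<bar> + 3 / 8) * \<bar>slope r s k \<theta>\<bar> / (2 + 4 * k)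
    \<le> 4 / 25 + (trig_eval (lin rm sm) \<theta> + k * trig_eval (quad sm) \<theta>) / 100"
proof -
  let ?g = "trig_eval (trig_deriv drift) \<theta>"
  let ?r = "trig_eval (trig_deriv r) \<theta>" and ?s = "trig_eval (trig_deriv s) \<theta>"
  let ?Z = "trig_eval (lin rm sm) \<theta>" and ?W = "trig_eval (quad sm) \<theta>"
  obtain e1 e2 :: int where e: "e1 \<in> {1, -1}" "e2 \<in> {1, -1}"
    "\<bar>?g\<bar> = of_int e1 * ?g" "\<bar>?r + k * ?s\<bar> = of_int e2 * (?r + k * ?s)"
    using obtain_sign by metis
  define F where "F = 8 * of_int e1 * ?g + 3"
  define P0 where "P0 = 2 * (256 + 16 * ?Z) - of_int e2 * F * ?r"
  define P1 where "P1 = 4 * (256 + 16 * ?Z) + 32 * ?W - of_int e2 * F * ?s"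
  have "-e2 \<in> {1, -1}" using e by auto
  note bspec[OF bspec[OF bspec[OF higher_order_m_certificate e(1)] this] assms(3)]
  then have "0 \<le> P0" "0 \<le> 4 * P0 + P1" "0 \<le> 4 * P0 + 2 * P1 + 64 * ?W"
    using trig_eval_nonneg[of _ \<theta>]
    unfolding P0_def P1_def F_def Let_def by (fastforce simp: algebra_simps)+
  then have "0 \<le> P0 + k * P1 + k\<^sup>2 * (64 * ?W)"
    using assms by (intro quadratic_nonneg) auto
  also have "\<dots> = (2 + 4 * k) * (256 + 16 * ?Z + 16 * (k * ?W)) - F * (of_int e2 * (?r + k * ?s))"
    unfolding P0_def P1_def by (simp add: algebra_simps power2_eq_square)
  finally have "F * \<bar>?r + k * ?s\<bar> \<le> (2 + 4 * k) * (256 + 16 * ?Z + 16 * (k * ?W))"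
    using e(4) by simp
  moreover have "F = 8 * (\<bar>?g\<bar> + 3 / 8)" unfolding F_def e(3) by simp
  ultimately have "(\<bar>?g\<bar> + 3 / 8) * \<bar>slope r s k \<theta>\<bar> \<le>
      (2 + 4 * k) * (4 / 25 + (?Z + k * ?W) / 100)"
    unfolding slope_def by (simp add: field_simps)
  then show ?thesis
    using assms by (simp add: pos_divide_le_eq mult.commute)
qed

lemma coupling_deriv3_bound: "\<bar>trig_eval (trig_deriv (trig_deriv (trig_deriv coupling))) \<theta>\<bar> \<le> 5"
  and drift_deriv2_bound: "\<bar>trig_eval (trig_deriv (trig_deriv drift)) \<theta>\<bar> \<le> 3"
  using derivative_bounds_certificate trig_eval_nonneg[of _ \<theta>] by (fastforce simp: abs_le_iff)+

text \<open>The bound is needed at the actual phase \<open>\<phi>\<close>, whereas the barrier is evaluated at the slow phase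
  \<open>\<theta>\<close>. The shift costs terms of size \<open>h D \<le> m\<close>, which the second component of the barrier is built
  to absorb; the errors \<open>O(D\<^sup>2)\<close> are absorbed by the term \<open>3 D\<^sup>2\<close> in \<open>a\<close>.\<close>

lemma barrier_strict_growth:
  fixes k D m h d a \<theta> \<phi> u v E g :: real
  defines "Q \<equiv> \<lambda>\<theta>. (a - 2 * m) * barrier rd sd k \<theta> + 2 * m * barrier rm sm k \<theta>"
    and "J \<equiv> \<lambda>\<theta>. (a - 2 * m) * slope rd sd k \<theta> + 2 * m * slope rm sm k \<theta>"
  assumes k: "0 < k" "k \<le> 1 / 2" and D: "0 < D" and m: "0 \<le> m" and h: "h * D \<le> m"
    and a: "d + 2 * m + 3 * D\<^sup>2 \<le> a" "(2 + 4 * k) * a \<le> D" and d: "0 \<le> d"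
    and phase: "\<bar>\<phi> - \<theta>\<bar> \<le> h"
    and g: "\<bar>g - trig_eval drift \<phi>\<bar> \<le> 3 / 2 * D\<^sup>2"
    and u: "\<bar>u\<bar> \<le> D" and v: "\<bar>v\<bar> \<le> m" and uv: "u + v = Q \<theta>"
    and E: "E \<le> 21 / 10 * D\<^sup>2"
  shows "d - trig_eval coupling \<phi> * u + E < (1 - k * g) * J \<theta>"
proof -
  let ?c = "trig_eval coupling" and ?c' = "trig_eval (trig_deriv coupling)"
    and ?c'' = "trig_eval (trig_deriv (trig_deriv coupling))"
  let ?g = "trig_eval drift" and ?g' = "trig_eval (trig_deriv drift)"
  define S where "S = max \<bar>slope rd sd k \<theta>\<bar> \<bar>slope rm sm k \<theta>\<bar>"
  have h0: "0 \<le> h" using phase by linarith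
  have "0 < D\<^sup>2" using D by simp
  have a0: "0 \<le> a - 2 * m" "0 \<le> a" "3 * D\<^sup>2 \<le> a"
    using a(1) d m \<open>0 < D\<^sup>2\<close> by linarith+
  have "2 * a \<le> (2 + 4 * k) * a" using k a0 by (intro mult_right_mono) auto
  then have aD: "2 * a \<le> D" using a by linarith
  have "6 * D * D \<le> 1 * D" using aD a0 by (simp add: power2_eq_square)
  then have D6: "6 * D \<le> 1" using D by (simp add: mult_le_cancel_right)
  \<comment> \<open>\<open>4 h D \<le> 4 m \<le> 2 a \<le> D\<close>. The fractions
    \<open>1/8\<close>, \<open>5/96\<close> and \<open>3/8\<close> in the budgets come from the
    resulting bound on \<open>h\<close>.\<close>
  have "4 * h * D \<le> 1 * D" using aD h a0 by auto
  then have h4: "h \<le> 1 / 4" using D by (simp add: mult_le_cancel_right)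
  have S: "0 \<le> S" "S \<le> 6" "\<bar>slope rd sd k \<theta>\<bar> \<le> S" "\<bar>slope rm sm k \<theta>\<bar> \<le> S"
    using barrier_bounds(3)[OF k] by (auto simp: S_def)
  have "\<bar>J \<theta>\<bar> \<le> (a - 2 * m) * \<bar>slope rd sd k \<theta>\<bar> + 2 * m * \<bar>slope rm sm k \<theta>\<bar>"
    unfolding J_def using a0 m by (intro order_trans[OF abs_triangle_ineq]) (simp add: abs_mult)
  also have "\<dots> \<le> (a - 2 * m) * S + 2 * m * S"
    using a0 m S by (intro add_mono mult_left_mono) auto
  also have "\<dots> = a * S" by (simp add: algebra_simps)
  finally have J: "\<bar>J \<theta>\<bar> \<le> a * S" .

  have c_shift: "\<bar>?c \<phi> - ?c \<theta>\<bar> \<le> h * (\<bar>?c' \<theta>\<bar> + \<bar>?c'' \<theta>\<bar> / 8 + 5 / 96)"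
  proof -
    have "h\<^sup>2 / 2 * \<bar>?c'' \<theta>\<bar> \<le> h * (1 / 8) * \<bar>?c'' \<theta>\<bar>"
      using mult_left_mono[OF h4 h0] by (intro mult_right_mono) (auto simp: power2_eq_square)
    moreover have "5 / 6 * h ^ 3 \<le> h * (5 / 96)"
      using h0 mult_left_mono[OF power_mono[OF h4 h0, of 2] h0]
      by (simp add: power2_eq_square power3_eq_cube)
    ultimately show ?thesis
      using trig_taylor_3[OF coupling_deriv3_bound phase] by (simp add: algebra_simps)
  qed
  have g_shift: "\<bar>?g \<phi> - ?g \<theta>\<bar> \<le> h * (\<bar>?g' \<theta>\<bar> + 3 / 8)"
  proof -
    have "\<bar>\<phi> - \<theta>\<bar>\<^sup>2 \<le> h\<^sup>2" using phase by (intro power_mono) auto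
    then have quadratic: "3 / 2 * (\<phi> - \<theta>)\<^sup>2 \<le> h * (3 / 8)"
      using mult_left_mono[OF h4 h0] by (simp add: power2_eq_square)
    have linear: "\<bar>?g' \<theta> * (\<phi> - \<theta>)\<bar> \<le> h * \<bar>?g' \<theta>\<bar>"
      unfolding abs_mult mult.commute[of h] using phase by (intro mult_left_mono) auto
    have "\<bar>?g \<phi> - ?g \<theta>\<bar> \<le> \<bar>?g \<phi> - ?g \<theta> - ?g' \<theta> * (\<phi> - \<theta>)\<bar> + \<bar>?g' \<theta> * (\<phi> - \<theta>)\<bar>"
      by linarith
    also have "\<dots> \<le> h * (3 / 8) + h * \<bar>?g' \<theta>\<bar>"
      by (intro add_mono linear order_trans[OF trig_taylor_2[OF drift_deriv2_bound] quadratic])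
    finally show ?thesis by (simp add: distrib_left)
  qed

  \<comment> \<open>The part with weight \<open>a - 2 m\<close> balances \<open>d\<close> and the
    errors in \<open>D\<^sup>2\<close>; the part with weight \<open>2 m\<close> is kept to pay for
    the phase shift and for \<open>v\<close>.\<close>
  have lower: "(a - 2 * m) + 2 * m * ((1 - k * ?g \<theta>) * slope rm sm k \<theta> + ?c \<theta> * barrier rm sm k \<theta>)
      \<le> (1 - k * ?g \<theta>) * J \<theta> + ?c \<theta> * Q \<theta>"
    using mult_left_mono[OF barrier_operator_d[OF k, of \<theta>] a0(1)]
    unfolding J_def Q_def by (simp add: algebra_simps)
  have shift_J: "k * \<bar>?g \<phi> - ?g \<theta>\<bar> * \<bar>J \<theta>\<bar> \<le> 2 * m * (k * ((\<bar>?g' \<theta>\<bar> + 3 / 8) * S / (2 + 4 * k)) / 2)"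
  proof -
    \<comment> \<open>Here \<open>(2 + 4 k) a \<le> D\<close> and \<open>h D \<le> m\<close> combine
      to produce the denominator in \<open>higher_order_m\<close>.\<close>
    have "(2 + 4 * k) * a * h \<le> D * h" using a h0 by (intro mult_right_mono) auto
    then have ha: "h * a \<le> m / (2 + 4 * k)"
      using h k by (simp add: pos_le_divide_eq algebra_simps)
    have "\<bar>?g \<phi> - ?g \<theta>\<bar> * \<bar>J \<theta>\<bar> \<le> (h * (\<bar>?g' \<theta>\<bar> + 3 / 8)) * (a * S)"
      using g_shift J h0 by (intro mult_mono) auto
    also have "\<dots> = (h * a) * ((\<bar>?g' \<theta>\<bar> + 3 / 8) * S)" by (simp add: algebra_simps)
    also have "\<dots> \<le> m / (2 + 4 * k) * ((\<bar>?g' \<theta>\<bar> + 3 / 8) * S)"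
      using ha S by (intro mult_right_mono) auto
    finally have "k * (\<bar>?g \<phi> - ?g \<theta>\<bar> * \<bar>J \<theta>\<bar>) \<le> k * (m / (2 + 4 * k) * ((\<bar>?g' \<theta>\<bar> + 3 / 8) * S))"
      using k by (intro mult_left_mono) auto
    moreover have "2 * m * (k * (y / w) / 2) = k * (m / w * y)" for y w :: real by simp
    ultimately show ?thesis by (simp only: mult.assoc)
  qed
  have ho: "(\<bar>?g' \<theta>\<bar> + 3 / 8) * S / (2 + 4 * k)
      \<le> 4 / 25 + (trig_eval (lin rm sm) \<theta> + k * trig_eval (quad sm) \<theta>) / 100"
    using higher_order_m[OF k, of rd sd \<theta>] higher_order_m[OF k, of rm sm \<theta>]
    unfolding S_def by (simp add: max_def)
  have mpart: "m * (\<bar>?c \<theta>\<bar> + \<bar>?c' \<theta>\<bar> + \<bar>?c'' \<theta>\<bar> / 8 + 5 / 96)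
      + 2 * m * (k * ((\<bar>?g' \<theta>\<bar> + 3 / 8) * S / (2 + 4 * k)) / 2)
      \<le> 2 * m * ((1 - k * ?g \<theta>) * slope rm sm k \<theta> + ?c \<theta> * barrier rm sm k \<theta>)"
  proof -
    have combine: "A + K \<le> 2 * (M / 200 + Z / 200)"
      if "K \<le> 2 / 25 + Z / 100" "A + 2 / 25 \<le> M / 100" for A K M Z :: real
      using that by simp
    have "k * ((\<bar>?g' \<theta>\<bar> + 3 / 8) * S / (2 + 4 * k)) \<le>
        k * (4 / 25 + (trig_eval (lin rm sm) \<theta> + k * trig_eval (quad sm) \<theta>) / 100)"
      using ho k by (intro mult_left_mono) auto
    also have "\<dots> \<le> 2 / 25 + k * (trig_eval (lin rm sm) \<theta> + k * trig_eval (quad sm) \<theta>) / 100"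
      using k by (simp add: algebra_simps)
    finally have bound: "\<bar>?c \<theta>\<bar> + \<bar>?c' \<theta>\<bar> + \<bar>?c'' \<theta>\<bar> / 8 + 5 / 96 + k * ((\<bar>?g' \<theta>\<bar> + 3 / 8) * S / (2 + 4 * k))
        \<le> 2 * ((1 - k * ?g \<theta>) * slope rm sm k \<theta> + ?c \<theta> * barrier rm sm k \<theta>)"
      unfolding barrier_operator using leading_order_m[of \<theta>] by (rule combine)
    have scale: "m * A + 2 * m * (K / 2) \<le> 2 * m * B" if "A + K \<le> 2 * B" for A K B
      using mult_left_mono[OF that m] by (simp add: algebra_simps)
    show ?thesis by (rule scale[OF bound])
  qed
  have cv: "?c \<theta> * v \<le> \<bar>?c \<theta>\<bar> * m"
  proof -
    have "?c \<theta> * v \<le> \<bar>?c \<theta>\<bar> * \<bar>v\<bar>" unfolding abs_mult[symmetric] by (rule abs_ge_self)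
    also have "\<dots> \<le> \<bar>?c \<theta>\<bar> * m" using v by (intro mult_left_mono) auto
    finally show ?thesis .
  qed
  have cu: "(?c \<theta> - ?c \<phi>) * u \<le> m * (\<bar>?c' \<theta>\<bar> + \<bar>?c'' \<theta>\<bar> / 8 + 5 / 96)"
  proof -
    have "(?c \<theta> - ?c \<phi>) * u \<le> \<bar>?c \<phi> - ?c \<theta>\<bar> * \<bar>u\<bar>"
      unfolding abs_mult[symmetric] abs_minus_commute[of "?c \<phi>"] by (simp add: abs_mult[symmetric])
    also have "\<dots> \<le> (h * (\<bar>?c' \<theta>\<bar> + \<bar>?c'' \<theta>\<bar> / 8 + 5 / 96)) * D"
      using c_shift u h0 by (intro mult_mono) auto
    also have "\<dots> = (h * D) * (\<bar>?c' \<theta>\<bar> + \<bar>?c'' \<theta>\<bar> / 8 + 5 / 96)" by (simp add: algebra_simps)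
    also have "\<dots> \<le> m * (\<bar>?c' \<theta>\<bar> + \<bar>?c'' \<theta>\<bar> / 8 + 5 / 96)"
      using h by (intro mult_right_mono) auto
    finally show ?thesis .
  qed
  have gJ: "k * (g - ?g \<phi>) * J \<theta> \<le> 3 / 8 * D\<^sup>2"
  proof -
    have "(g - ?g \<phi>) * J \<theta> \<le> \<bar>g - ?g \<phi>\<bar> * \<bar>J \<theta>\<bar>" 
      unfolding abs_mult[symmetric] by (rule abs_ge_self)
    also have "\<dots> \<le> (3 / 2 * D\<^sup>2) * (a * S)" using g J by (intro mult_mono) auto
    also have "\<dots> \<le> (3 / 2 * D\<^sup>2) * (D / 2 * 6)"
      using aD a0 S D by (intro mult_left_mono mult_mono) auto
    also have "\<dots> \<le> (3 / 2 * D\<^sup>2) * (1 / 2)"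
      using D6 by (intro mult_left_mono) auto
    finally have "k * ((g - ?g \<phi>) * J \<theta>) \<le> k * (3 / 4 * D\<^sup>2)"
      using k by (intro mult_left_mono) auto
    also have "\<dots> \<le> 1 / 2 * (3 / 4 * D\<^sup>2)" using k by (intro mult_right_mono) auto
    finally show ?thesis by (simp add: mult.assoc)
  qed
  have gs: "k * (?g \<phi> - ?g \<theta>) * J \<theta> \<le> k * \<bar>?g \<phi> - ?g \<theta>\<bar> * \<bar>J \<theta>\<bar>"
  proof -
    have "(?g \<phi> - ?g \<theta>) * J \<theta> \<le> \<bar>?g \<phi> - ?g \<theta>\<bar> * \<bar>J \<theta>\<bar>"
      unfolding abs_mult[symmetric] by (rule abs_ge_self)
    from mult_left_mono[OF this, of k] k show ?thesis by (simp add: mult.assoc)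
  qed
  have split_l: "d - ?c \<phi> * u + E = d + ?c \<theta> * v + (?c \<theta> - ?c \<phi>) * u - ?c \<theta> * Q \<theta> + E"
    unfolding uv[symmetric] by (simp add: algebra_simps)
  have split_r: "(1 - k * g) * J \<theta> =
      (1 - k * ?g \<theta>) * J \<theta> - k * (?g \<phi> - ?g \<theta>) * J \<theta> - k * (g - ?g \<phi>) * J \<theta>"
    by (simp add: algebra_simps)
  have split_m: "m * (\<bar>?c \<theta>\<bar> + \<bar>?c' \<theta>\<bar> + \<bar>?c'' \<theta>\<bar> / 8 + 5 / 96) =
      \<bar>?c \<theta>\<bar> * m + m * (\<bar>?c' \<theta>\<bar> + \<bar>?c'' \<theta>\<bar> / 8 + 5 / 96)"
    by (simp add: algebra_simps)
  \<comment> \<open>Strictness comes from \<open>21/10 + 3/8 < 3\<close>: the errors leave part of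
    the \<open>3 D\<^sup>2\<close> contained in \<open>a\<close>.\<close>
  have combine: "l < r" if "l = d + V + X - CQ + E" "r = P - G1 - G2" "M = Mc + Mu"
      "a - 2 * m + T \<le> P + CQ" "K \<le> s" "M + s \<le> T" "V \<le> Mc" "X \<le> Mu"
      "G2 \<le> 3 / 8 * D\<^sup>2" "G1 \<le> K" for l r V X CQ P G1 G2 M Mc Mu T K s
    using that a(1) E \<open>0 < D\<^sup>2\<close> by linarith
  show ?thesis
    by (rule combine[OF split_l split_r split_m lower shift_J mpart cv cu gJ gs])
qed

section \<open>The constants \<open>L\<close> and \<open>R\<close>\<close>

text \<open>\<open>3/16 = 1/6 + (3/120) (5/6)\<close>: the fifth-order remainder is charged to the
  cubic term. The range \<open>4/5\<close> suits \<open>y = k pi / 2\<close> with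
  \<open>k \<le> 1/2\<close>.\<close>

lemma sinh_le_cubic:
  fixes y :: real
  assumes "0 \<le> y" "y \<le> 4 / 5"
  shows "sinh y \<le> y + 3 / 16 * y ^ 3"
proof -
  define diff where "diff n = (if even n then sinh else cosh :: real \<Rightarrow> real)" for n :: nat
  have "\<forall>m x. DERIV (diff m) x :> diff (Suc m) x"
    by (auto simp: diff_def intro!: derivative_eq_intros)
  then obtain t where t: "\<bar>t\<bar> \<le> \<bar>y\<bar>"
    "sinh y = (\<Sum>m<5. diff m 0 / fact m * y ^ m) + diff 5 t / fact 5 * y ^ 5"
    using Maclaurin_all_le[of diff sinh y 5] by (auto simp: diff_def)
  have "cosh t = cosh \<bar>t\<bar>" by simp
  also have "\<dots> \<le> exp \<bar>t\<bar>" unfolding cosh_field_def by simp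
  also have "\<dots> \<le> exp 1" using t assms by simp
  also have "\<dots> \<le> 3" by (rule exp_le)
  finally have cosh_le_3: "cosh t \<le> 3" .
  have "y\<^sup>2 \<le> (4 / 5)\<^sup>2" using assms by (intro power_mono) auto
  then have y2: "y\<^sup>2 \<le> 5 / 6" by (simp add: power2_eq_square)
  have "sinh y = y + y ^ 3 / 6 + cosh t / 120 * y ^ 5"
  proof -
    have "{..<5 :: nat} = {0, 1, 2, 3, 4}" by auto
    then show ?thesis unfolding t(2) by (simp add: diff_def fact_numeral)
  qed
  also have "\<dots> \<le> y + y ^ 3 / 6 + 3 / 120 * y ^ 5"
    using cosh_le_3 assms by (intro add_left_mono mult_right_mono) auto
  also have "y ^ 5 = y ^ 3 * y\<^sup>2" by (simp flip: power_add)
  also have "y + y ^ 3 / 6 + 3 / 120 * (y ^ 3 * y\<^sup>2) \<le> y + y ^ 3 / 6 + 3 / 120 * (y ^ 3 * (5 / 6))"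
    using y2 assms by (intro add_left_mono mult_left_mono) auto
  finally show ?thesis by simp
qed

lemma sinh_gt_self:
  fixes y :: real
  assumes "0 < y"
  shows "y < sinh y"
proof -
  have "sinh 0 - 0 < sinh y - y"
  proof (rule DERIV_pos_imp_increasing_open[OF assms])
    fix x :: real assume "0 < x" "x < y"
    then have "0 < cosh x - 1" using cosh_real_ge_1[of x] cosh_real_one_iff[of x] by linarith
    moreover have "((\<lambda>x. sinh x - x) has_real_derivative cosh x - 1) (at x)"
      by (auto intro!: derivative_eq_intros)
    ultimately show "\<exists>l. ((\<lambda>x. sinh x - x) has_real_derivative l) (at x) \<and> 0 < l" by blast
  qed (auto intro!: continuous_intros)
  then show ?thesis by simp
qed

text \<open>Machin's formula \<open>pi / 4 = 4 arctan (1/5) - arctan (1/239)\<close>.\<close>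

lemma pi_le_16_5: "pi \<le> 16 / 5"
proof -
  have "arctan (1 / 5) \<le> 1 / 5"
    by (rule arctan_le_self) simp
  moreover have "0 < arctan (1 / 239)" by simp
  ultimately show ?thesis using machin by linarith
qed

text \<open>With \<open>y = k pi / 2\<close>, the denominator \<open>1 - exp (-2 y)\<close> is
  \<open>2 exp (-y) sinh y\<close>, and \<open>exp (-y)\<close> cancels against the
  numerators.\<close>

lemma R_const_eq:
  "R_const \<kappa> \<nu> = exp (2 * (\<kappa> / mean \<nu>)) / (2 * sinh (\<kappa> / mean \<nu> * pi / 2))"
  and L_const_eq:
  "L_const \<kappa> \<nu> = exp (- (2 * (\<kappa> / mean \<nu>))) / (2 * sinh (\<kappa> / mean \<nu> * pi / 2))"
proof -
  define k y where "k = \<kappa> / mean \<nu>" and "y = k * pi / 2"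
  have d: "1 - exp (- (\<kappa> * pi / mean \<nu>)) = exp (- y) * (2 * sinh y)"
  proof -
    have "\<kappa> * pi / mean \<nu> = 2 * y" by (simp add: k_def y_def mult.commute)
    moreover have "exp (- (2 * y)) = exp (- y) * exp (- y)" "exp (- y) * exp y = 1"
      by (simp_all add: mult_exp_exp)
    ultimately show ?thesis
      by (simp add: sinh_field_def algebra_simps)
  qed
  \<comment> \<open>For \<open>mean \<nu> = 0\<close> all terms vanish, division by zero being
    zero.\<close>
  have n: "(4 - pi) * \<kappa> / (2 * mean \<nu>) = - y + 2 * k" "- ((4 + pi) * \<kappa> / (2 * mean \<nu>)) = - y + - (2 * k)"
    by (cases "mean \<nu> = 0"; simp add: k_def y_def field_simps)+
  show "R_const \<kappa> \<nu> = exp (2 * (\<kappa> / mean \<nu>)) / (2 * sinh (\<kappa> / mean \<nu> * pi / 2))"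
    unfolding R_const_def d n exp_add k_def[symmetric] y_def[symmetric] by simp
  show "L_const \<kappa> \<nu> = exp (- (2 * (\<kappa> / mean \<nu>))) / (2 * sinh (\<kappa> / mean \<nu> * pi / 2))"
    unfolding L_const_def d n exp_add k_def[symmetric] y_def[symmetric] by simp
qed

text \<open>The right side is \<open>2 exp (2 k) y / sinh y\<close> with
  \<open>y = k pi / 2\<close>. A cubic bound for \<open>sinh\<close> and a Taylor polynomial for
  \<open>exp\<close> leave a comparison of polynomials in \<open>k\<close>.\<close>

lemma R_const_lower:
  assumes "0 < k" "k \<le> 1 / 2" "k = \<kappa> / mean \<nu>"
  shows "2 + 4 * k + 3 * k\<^sup>2 \<le> 2 * pi * k * R_const \<kappa> \<nu>"
proof -
  define y where "y = k * pi / 2"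
  have y: "0 < y" "y \<le> 4 / 5" "y \<le> 8 / 5 * k"
  proof -
    have "k * pi \<le> k * (16 / 5)" using pi_le_16_5 assms by (intro mult_left_mono) auto
    then show "y \<le> 8 / 5 * k" by (simp add: y_def)
    then show "y \<le> 4 / 5" using assms(2) by linarith
  qed (use assms(1) in \<open>simp add: y_def\<close>)
  have "y\<^sup>2 \<le> (8 / 5 * k)\<^sup>2" using y by (intro power_mono) auto
  then have y2: "3 / 16 * y\<^sup>2 \<le> 12 / 25 * k\<^sup>2" by (simp add: power2_eq_square)
  have "sinh y \<le> y * (1 + 3 / 16 * y\<^sup>2)"
    using sinh_le_cubic[of y] y by (simp add: algebra_simps power2_eq_square power3_eq_cube)
  also have "\<dots> \<le> y * (1 + 12 / 25 * k\<^sup>2)" using y y2 by (intro mult_left_mono) auto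
  finally have s: "sinh y \<le> y * (1 + 12 / 25 * k\<^sup>2)" .
  obtain t where t: "exp (2 * k) = (\<Sum>m<4. (2 * k) ^ m / fact m) + exp t / fact 4 * (2 * k) ^ 4"
    using Maclaurin_exp_le[of "2 * k" 4] by blast
  have "0 \<le> exp t / fact 4 * (2 * k) ^ 4" using assms by simp
  then have e: "1 + 2 * k + 2 * k\<^sup>2 + 4 / 3 * k ^ 3 \<le> exp (2 * k)"
    unfolding t by (simp add: eval_nat_numeral)
  have "(2 + 4 * k + 3 * k\<^sup>2) * sinh y \<le> (2 + 4 * k + 3 * k\<^sup>2) * (y * (1 + 12 / 25 * k\<^sup>2))"
    using s assms by (intro mult_left_mono) auto
  also have "\<dots> = y * ((2 + 4 * k + 3 * k\<^sup>2) * (1 + 12 / 25 * k\<^sup>2))" by simp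
  also have "\<dots> \<le> y * (2 * (1 + 2 * k + 2 * k\<^sup>2 + 4 / 3 * k ^ 3))"
  proof (intro mult_left_mono)
    \<comment> \<open>After \<open>k^4 \<le> k^3 / 2\<close> the coefficients compare termwise:
      \<open>99/25 < 4\<close> and \<open>66/25 < 8/3\<close>.\<close>
    have "k ^ 3 * k \<le> k ^ 3 * (1 / 2)" using assms by (intro mult_left_mono) auto
    then have "k ^ 4 \<le> k ^ 3 / 2" by (simp add: eval_nat_numeral)
    moreover have "0 \<le> k ^ 3" "0 \<le> k\<^sup>2" using assms by auto
    moreover have expand: "(2 + 4 * k + 3 * k\<^sup>2) * (1 + 12 / 25 * k\<^sup>2) =
        2 + 4 * k + 99 / 25 * k\<^sup>2 + 48 / 25 * k ^ 3 + 36 / 25 * k ^ 4"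
      by (simp add: algebra_simps eval_nat_numeral)
    ultimately show "(2 + 4 * k + 3 * k\<^sup>2) * (1 + 12 / 25 * k\<^sup>2) \<le>
        2 * (1 + 2 * k + 2 * k\<^sup>2 + 4 / 3 * k ^ 3)"
      unfolding expand by argo
  qed (use y in simp)
  also have "\<dots> \<le> y * (2 * exp (2 * k))" using e y by (intro mult_left_mono) auto
  finally have "2 + 4 * k + 3 * k\<^sup>2 \<le> y * (2 * exp (2 * k)) / sinh y"
    using y by (simp add: pos_le_divide_eq)
  also have "\<dots> = 2 * pi * k * R_const \<kappa> \<nu>"
    unfolding R_const_eq assms(3)[symmetric] y_def by simp
  finally show ?thesis .
qed

text \<open>Here \<open>y / sinh y < 1\<close>, and
  \<open>(1 - 2 k + 2 k^2) (1 + 2 k + 2 k^2) = 1 + 4 k^4\<close> turns the lower Taylor bound for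
  \<open>exp (2 k)\<close> into an upper bound for its reciprocal.\<close>

lemma L_const_upper:
  assumes "0 < k" "k \<le> 1 / 2" "k = \<kappa> / mean \<nu>"
  shows "2 * pi * k * L_const \<kappa> \<nu> < 2 - 4 * k + 4 * k\<^sup>2"
proof -
  define y where "y = k * pi / 2"
  have y: "0 < y" using assms(1) by (simp add: y_def)
  have "2 * pi * k * L_const \<kappa> \<nu> = y / sinh y * (2 * exp (- (2 * k)))"
    unfolding L_const_eq assms(3)[symmetric] y_def by simp
  also have "\<dots> < 1 * (2 * exp (- (2 * k)))"
    using sinh_gt_self[OF y] y by (intro mult_strict_right_mono) auto
  also have "exp (- (2 * k)) = 1 / exp (2 * k)" by (simp add: exp_minus field_simps)
  also have "1 / exp (2 * k) \<le> 1 / (1 + 2 * k + (2 * k)\<^sup>2 / 2)"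
    using exp_lower_Taylor_quadratic[of "2 * k"] assms by (intro divide_left_mono) (auto intro!: mult_pos_pos add_pos_nonneg)
  also have "1 / (1 + 2 * k + (2 * k)\<^sup>2 / 2) \<le> 1 - 2 * k + 2 * k\<^sup>2"
  proof -
    have "(1 - 2 * k + 2 * k\<^sup>2) * (1 + 2 * k + (2 * k)\<^sup>2 / 2) = 1 + 4 * k ^ 4"
      by (simp add: algebra_simps eval_nat_numeral)
    then show ?thesis
      using assms by (simp add: pos_divide_le_eq add_pos_nonneg)
  qed
  finally show ?thesis by simp
qed

section \<open>Differential inequalities and mean-field estimates\<close>

lemma at_within_Ici:
  fixes t :: real
  assumes "0 < t"
  shows "at t within {0..} = at t"
  by (rule at_within_open_subset[of t "{0<..}"]) (use assms in auto)

text \<open>Integrating factor \<open>exp (\<gamma> * t)\<close> and the mean value theorem. The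
  inequality is asked for only strictly before \<open>T\<close>, so it may rest on bounds known only
  before a critical time.\<close>

lemma linear_ode_upper_bound:
  fixes y :: "real \<Rightarrow> real"
  assumes deriv: "\<And>t. 0 \<le> t \<Longrightarrow> (y has_real_derivative y' t) (at t within {0..})"
    and ineq: "\<And>t. 0 < t \<Longrightarrow> t < T \<Longrightarrow> y' t \<le> \<gamma> * (B - y t)"
    and init: "y 0 \<le> B" and T: "0 \<le> T"
  shows "y T \<le> B"
proof (cases "T = 0")
  case False
  define f where "f t = exp (\<gamma> * t) * (y t - B)" for t
  have d: "(f has_real_derivative exp (\<gamma> * t) * (\<gamma> * (y t - B) + y' t)) (at t within {0..})" if "0 \<le> t" for t
    unfolding f_def[abs_def] using deriv[OF that]
    by (auto intro!: derivative_eq_intros simp: algebra_simps)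
  have "continuous_on {0..} f"
    using d by (intro DERIV_continuous_on) auto
  then have "continuous_on {0..T} f" by (rule continuous_on_subset) auto
  moreover have d': "(f has_real_derivative exp (\<gamma> * t) * (\<gamma> * (y t - B) + y' t)) (at t)" if "0 < t" for t
    using d[of t] that by (simp add: at_within_Ici)
  ultimately obtain l z where z: "0 < z" "z < T" "(f has_real_derivative l) (at z)" "f T - f 0 = (T - 0) * l"
    using MVT[of 0 T f] False T by (metis less_eq_real_def real_differentiable_def)
  have "l = exp (\<gamma> * z) * (\<gamma> * (y z - B) + y' z)"
    using DERIV_unique[OF z(3) d'[OF z(1)]] .
  moreover have "\<gamma> * (y z - B) + y' z \<le> 0"
    using ineq[OF z(1,2)] by (simp add: algebra_simps)
  ultimately have "l \<le> 0" by (simp add: mult_nonneg_nonpos)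
  then have "(T - 0) * l \<le> 0" using T by (intro mult_nonneg_nonpos) auto
  with z have "f T \<le> f 0" by linarith
  also have "f 0 \<le> 0" using init by (simp add: f_def)
  finally show ?thesis by (simp add: f_def mult_le_0_iff)
qed (use init in simp)

text \<open>At a first zero a positive derivative would force negative values just before it, where
  \<open>f\<close> is still positive.\<close>

lemma positive_if_increasing_at_zeros:
  fixes f :: "real \<Rightarrow> real"
  assumes deriv: "\<And>t. 0 \<le> t \<Longrightarrow> (f has_real_derivative f' t) (at t within {0..})"
    and zeros: "\<And>t. 0 < t \<Longrightarrow> t \<le> T \<Longrightarrow> f t = 0 \<Longrightarrow> 0 < f' t"
    and init: "0 < f 0" and T: "0 \<le> T"
  shows "0 < f T"
proof (rule ccontr)
  assume neg: "\<not> 0 < f T"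
  have cont: "continuous_on {0..} f"
    using deriv by (intro DERIV_continuous_on) auto
  define S where "S = {0..T} \<inter> f -` {..0}"
  have "closed S"
    unfolding S_def by (intro continuous_closed_preimage continuous_on_subset[OF cont]) auto
  moreover have "T \<in> S" using neg T by (auto simp: S_def)
  moreover have bdd: "bdd_below S" by (auto simp: S_def bdd_below_def)
  ultimately have InfS: "Inf S \<in> S" using closed_contains_Inf by blast
  define s where "s = Inf S"
  have s: "0 \<le> s" "s \<le> T" "f s \<le> 0" using InfS by (auto simp: S_def s_def)
  then have s0: "0 < s" using init by (cases "s = 0") auto
  have before: "0 < f t" if "0 \<le> t" "t < s" for t
  proof (rule ccontr)
    assume "\<not> 0 < f t"
    then have "t \<in> S" using that s by (auto simp: S_def)
    then have "s \<le> t" unfolding s_def using bdd by (rule cInf_lower)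
    with that show False by simp
  qed
  have "\<not> f s < 0"
  proof
    assume "f s < 0"
    then obtain x where "0 \<le> x" "x \<le> s" "f x = 0"
      using IVT2'[of f s 0 0] init s continuous_on_subset[OF cont, of "{0..s}"] by auto
    with before[of x] \<open>f s < 0\<close> show False by (cases "x = s") auto
  qed
  with s have "f s = 0" by simp
  then have "0 < f' s" using zeros s0 s by blast
  moreover have "(f has_real_derivative f' s) (at s)"
    using deriv[of s] s0 by (simp add: at_within_Ici)
  ultimately obtain d where d: "d > 0" "\<And>h. 0 < h \<Longrightarrow> h < d \<Longrightarrow> f (s - h) < f s"
    using DERIV_pos_inc_left by blast
  define h where "h = min (d / 2) (s / 2)"
  have "0 < h" "h < d" "h < s" using d s0 by (auto simp: h_def)
  with d(2)[of h] before[of "s - h"] \<open>f s = 0\<close> show False by simp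
qed

section \<open>Spread, mean and mean-field averages\<close>

lemma spread_ge: "x $ i - x $ j \<le> spread x"
proof -
  have "{\<bar>x $ i - x $ j\<bar> | i j. True} = (\<lambda>(i, j). \<bar>x $ i - x $ j\<bar>) ` UNIV" by auto
  then have "finite {\<bar>x $ i - x $ j\<bar> | i j. True}" by simp
  then have "\<bar>x $ i - x $ j\<bar> \<le> spread x"
    unfolding spread_def by (intro Max_ge) auto
  then show ?thesis by simp
qed

lemma spread_le:
  assumes "\<And>i j. x $ i - x $ j \<le> B"
  shows "spread x \<le> B"
proof -
  have "{\<bar>x $ i - x $ j\<bar> | i j. True} = (\<lambda>(i, j). \<bar>x $ i - x $ j\<bar>) ` UNIV" by auto
  then have "finite {\<bar>x $ i - x $ j\<bar> | i j. True}" by simp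
  moreover have "\<bar>x $ i - x $ j\<bar> \<le> B" for i j
    using assms[of i j] assms[of j i] by linarith
  ultimately show ?thesis
    unfolding spread_def by (intro Max.boundedI) auto
qed

lemma spread_nonneg: "0 \<le> spread x"
  using spread_ge[of x undefined undefined] by simp

lemma component_minus_mean_le:
  fixes x :: "real ^ 'n"
  assumes "\<And>i j. x $ i - x $ j \<le> D"
  shows "\<bar>x $ i - mean x\<bar> \<le> D"
proof -
  have e: "x $ i - mean x = (\<Sum>j\<in>UNIV. x $ i - x $ j) / real CARD('n)"
    by (simp add: mean_def sum_subtractf field_simps)
  have "\<bar>\<Sum>j\<in>UNIV. x $ i - x $ j\<bar> \<le> (\<Sum>j\<in>(UNIV :: 'n set). D)"
    using assms by (intro order_trans[OF sum_abs] sum_mono) (smt (verit))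
  then have "\<bar>\<Sum>j\<in>UNIV. x $ i - x $ j\<bar> \<le> real CARD('n) * D"
    by simp
  then show ?thesis
    unfolding e by (simp add: field_simps)
qed

text \<open>In the expansion about the mean the first-order terms average to zero, so the error is
  quadratic in \<open>D\<close>.\<close>

lemma mean_trig_eval:
  fixes x :: "real ^ 'n"
  assumes "\<And>i j. x $ i - x $ j \<le> D"
    and "\<And>z. \<bar>trig_eval (trig_deriv (trig_deriv t)) z\<bar> \<le> 1"
  shows "\<bar>mean (\<chi> i. trig_eval t (x $ i)) - trig_eval t (mean x)\<bar> \<le> D\<^sup>2 / 2"
proof -
  let ?m = "mean x"
  let ?r = "\<lambda>i. trig_eval t (x $ i) - trig_eval t ?m - trig_eval (trig_deriv t) ?m * (x $ i - ?m)"
  have "(\<Sum>i\<in>UNIV. x $ i - ?m) = 0"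
    by (simp add: mean_def sum_subtractf)
  then have "(\<Sum>i\<in>UNIV. trig_eval (trig_deriv t) ?m * (x $ i - ?m)) = 0"
    by (simp flip: sum_distrib_left)
  then have "(\<Sum>i\<in>UNIV. ?r i) = (\<Sum>i\<in>UNIV. trig_eval t (x $ i)) - real CARD('n) * trig_eval t ?m"
    by (simp add: sum_subtractf)
  then have e: "mean (\<chi> i. trig_eval t (x $ i)) - trig_eval t ?m = (\<Sum>i\<in>UNIV. ?r i) / real CARD('n)"
    by (simp add: mean_def field_simps)
  have "\<bar>?r i\<bar> \<le> D\<^sup>2 / 2" for i
  proof -
    have "\<bar>?r i\<bar> \<le> 1 / 2 * (x $ i - ?m)\<^sup>2" by (rule trig_taylor_2[OF assms(2)])
    also have "(x $ i - ?m)\<^sup>2 = \<bar>x $ i - ?m\<bar>\<^sup>2" by simp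
    also have "\<dots> \<le> D\<^sup>2"
      using component_minus_mean_le[OF assms(1)] by (intro power_mono) auto
    finally show ?thesis by simp
  qed
  then have "\<bar>\<Sum>i\<in>UNIV. ?r i\<bar> \<le> (\<Sum>i\<in>(UNIV :: 'n set). D\<^sup>2 / 2)"
    by (intro order_trans[OF sum_abs] sum_mono) 
  then have "\<bar>\<Sum>i\<in>UNIV. ?r i\<bar> \<le> real CARD('n) * (D\<^sup>2 / 2)"
    by simp
  then show ?thesis
    unfolding e by (simp add: field_simps)
qed

lemma mean_bounds:
  fixes x :: "real ^ 'n"
  assumes "\<And>i. \<bar>x $ i\<bar> \<le> B"
  shows "\<bar>mean x\<bar> \<le> B"
proof -
  have "\<bar>\<Sum>i\<in>UNIV. x $ i\<bar> \<le> (\<Sum>i\<in>(UNIV :: 'n set). B)"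
    using assms by (intro order_trans[OF sum_abs] sum_mono) 
  then have "\<bar>\<Sum>i\<in>UNIV. x $ i\<bar> \<le> real CARD('n) * B" by simp
  then show ?thesis by (simp add: mean_def field_simps)
qed

lemma abs_cos_diff_le: "\<bar>cos a - cos b\<bar> \<le> \<bar>a - b\<bar>" for a b :: real
proof -
  have "\<bar>cos a - cos b\<bar> = 2 * (\<bar>sin ((a + b) / 2)\<bar> * \<bar>sin ((b - a) / 2)\<bar>)"
    by (simp add: cos_diff_cos abs_mult)
  also have "\<dots> \<le> 2 * (1 * \<bar>(b - a) / 2\<bar>)"
    by (intro mult_left_mono mult_mono abs_sin_x_le_abs_x) auto
  finally show ?thesis by (simp add: abs_minus_commute)
qed

lemma abs_sin_diff_le: "\<bar>sin a - sin b\<bar> \<le> \<bar>a - b\<bar>" for a b :: real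
  using abs_cos_diff_le[of "a - pi / 2" "b - pi / 2"] by (simp add: cos_diff)

text \<open>The averages are within \<open>D^2 / 2\<close> of their values at the mean phase. For
  the second bound, the difference of sines is \<open>u cos z\<close> with \<open>z\<close> within
  \<open>D\<close> of the mean, and \<open>D \<le> 1/6\<close> absorbs the cubic error.\<close>

lemma mean_field_estimates:
  fixes x :: "real ^ 'n"
  defines "\<theta> \<equiv> mean x" and "S \<equiv> mean (\<chi> i. sin (x $ i))" and "A \<equiv> 1 + mean (\<chi> i. cos (x $ i))"
  assumes pair: "\<And>i j. x $ i - x $ j \<le> D" and D: "0 < D" "D \<le> 1 / 6"
  shows "\<bar>S * A - trig_eval drift \<theta>\<bar> \<le> 3 / 2 * D\<^sup>2"
    and "trig_eval coupling \<theta> * (x $ i - x $ j) - (sin (x $ i) - sin (x $ j)) * A \<le> 21 / 10 * D\<^sup>2"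
proof -
  have A: "\<bar>A\<bar> \<le> 2"
    using mean_bounds[of "\<chi> i. cos (x $ i)" 1] unfolding A_def by simp
  have s: "\<bar>S - sin \<theta>\<bar> \<le> D\<^sup>2 / 2"
    using mean_trig_eval[OF pair, of Sin] unfolding S_def \<theta>_def by simp
  have c: "\<bar>(A - 1) - cos \<theta>\<bar> \<le> D\<^sup>2 / 2"
    using mean_trig_eval[OF pair, of Cos] unfolding A_def \<theta>_def by simp
  have "S * A - trig_eval drift \<theta> = (S - sin \<theta>) * A + sin \<theta> * ((A - 1) - cos \<theta>)"
    by (simp add: drift_def algebra_simps)
  also have "\<bar>\<dots>\<bar> \<le> \<bar>S - sin \<theta>\<bar> * \<bar>A\<bar> + \<bar>sin \<theta>\<bar> * \<bar>(A - 1) - cos \<theta>\<bar>"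
    unfolding abs_mult[symmetric] by (rule abs_triangle_ineq)
  also have "\<dots> \<le> D\<^sup>2 / 2 * 2 + 1 * (D\<^sup>2 / 2)"
    using s c A by (intro add_mono mult_mono) auto
  finally show "\<bar>S * A - trig_eval drift \<theta>\<bar> \<le> 3 / 2 * D\<^sup>2" by simp

  define u where "u = x $ i - x $ j"
  have u: "\<bar>u\<bar> \<le> D" using pair[of i j] pair[of j i] by (simp add: u_def)
  obtain z where z: "sin (x $ i) - sin (x $ j) = u * cos z" "\<bar>z - \<theta>\<bar> \<le> D"
  proof -
    have near: "\<bar>x $ i - \<theta>\<bar> \<le> D" for i
      unfolding \<theta>_def by (rule component_minus_mean_le[OF pair])
    have mvt: "\<exists>z. a < z \<and> z < b \<and> sin b - sin a = (b - a) * cos z" if "a < b" for a b :: real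
      using MVT2[OF that, of sin cos] by (auto intro: derivative_intros)
    consider "x $ i = x $ j" | "x $ i < x $ j" | "x $ j < x $ i" by linarith
    then show ?thesis
    proof cases
      case 1
      then show ?thesis using that[of \<theta>] D by (simp add: u_def)
    next
      case 2
      from mvt[OF 2] obtain z where "x $ i < z" "z < x $ j" "sin (x $ j) - sin (x $ i) = (x $ j - x $ i) * cos z"
        by blast
      then show ?thesis using that[of z] near[of i] near[of j] by (simp add: u_def algebra_simps abs_le_iff)
    next
      case 3
      from mvt[OF 3] obtain z where "x $ j < z" "z < x $ i" "sin (x $ i) - sin (x $ j) = (x $ i - x $ j) * cos z"
        by blast
      then show ?thesis using that[of z] near[of i] near[of j] by (simp add: u_def abs_le_iff)
    qed
  qed
  have "\<bar>cos \<theta> - cos z\<bar> \<le> \<bar>\<theta> - z\<bar>" by (rule abs_cos_diff_le)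
  then have cz: "\<bar>cos \<theta> - cos z\<bar> \<le> D" using z(2) by linarith
  have "trig_eval coupling \<theta> * u - u * cos z * A =
      u * ((cos \<theta> - cos z) * A - cos \<theta> * ((A - 1) - cos \<theta>))"
    by (simp add: coupling_def algebra_simps)
  also have "\<dots> \<le> \<bar>u\<bar> * (\<bar>cos \<theta> - cos z\<bar> * \<bar>A\<bar> + \<bar>cos \<theta>\<bar> * \<bar>(A - 1) - cos \<theta>\<bar>)"
  proof -
    have "u * ((cos \<theta> - cos z) * A - cos \<theta> * ((A - 1) - cos \<theta>)) \<le>
        \<bar>u\<bar> * \<bar>(cos \<theta> - cos z) * A - cos \<theta> * ((A - 1) - cos \<theta>)\<bar>"
      unfolding abs_mult[symmetric] by (rule abs_ge_self)
    also have "\<dots> \<le> \<bar>u\<bar> * (\<bar>cos \<theta> - cos z\<bar> * \<bar>A\<bar> + \<bar>cos \<theta>\<bar> * \<bar>(A - 1) - cos \<theta>\<bar>)"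
      unfolding abs_mult[symmetric, of "cos \<theta> - cos z"] abs_mult[symmetric, of "cos \<theta>"]
      by (intro mult_left_mono abs_triangle_ineq4) auto
    finally show ?thesis .
  qed
  also have "\<dots> \<le> D * (D * 2 + 1 * (D\<^sup>2 / 2))"
    using u cz A c D by (intro mult_mono add_mono) auto
  also have "\<dots> = 2 * D\<^sup>2 + D / 2 * D\<^sup>2" by (simp add: algebra_simps power2_eq_square)
  also have "\<dots> \<le> 2 * D\<^sup>2 + 1 / 10 * D\<^sup>2"
    using D by (intro add_left_mono mult_right_mono) auto
  finally show "trig_eval coupling \<theta> * (x $ i - x $ j) - (sin (x $ i) - sin (x $ j)) * A \<le> 21 / 10 * D\<^sup>2"
    unfolding z(1) u_def[symmetric] by simp
qed

section \<open>Equations of motion for components and means\<close>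

lemma winfree_inertia_solution_derivatives:
  fixes \<nu> :: "real ^ 'n"
  assumes sol: "winfree_inertia_solution \<gamma> \<kappa> \<nu> \<Theta> \<Omega>" and t: "0 \<le> t"
  defines "S \<equiv> mean (\<chi> j. sin (\<Theta> t $ j))" and "A \<equiv> 1 + mean (\<chi> j. cos (\<Theta> t $ j))"
  shows "((\<lambda>s. \<Theta> s $ i) has_real_derivative \<Omega> t $ i) (at t within {0..})"
    and "((\<lambda>s. \<Omega> s $ i) has_real_derivative - \<gamma> * \<Omega> t $ i + \<nu> $ i - \<kappa> * sin (\<Theta> t $ i) * A) (at t within {0..})"
    and "((\<lambda>s. mean (\<Theta> s)) has_real_derivative mean (\<Omega> t)) (at t within {0..})"
    and "((\<lambda>s. mean (\<Omega> s)) has_real_derivative - \<gamma> * mean (\<Omega> t) + mean \<nu> - \<kappa> * (S * A)) (at t within {0..})"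
proof -
  show theta: "((\<lambda>s. \<Theta> s $ i) has_real_derivative \<Omega> t $ i) (at t within {0..})" for i
    using sol t unfolding winfree_inertia_solution_def by blast
  have "\<kappa> / real CARD('n) * sin (\<Theta> t $ i) * (\<Sum>j\<in>UNIV. 1 + cos (\<Theta> t $ j)) = \<kappa> * sin (\<Theta> t $ i) * A" for i
    unfolding A_def by (simp add: mean_def sum.distrib field_simps)
  then show omega: "((\<lambda>s. \<Omega> s $ i) has_real_derivative - \<gamma> * \<Omega> t $ i + \<nu> $ i - \<kappa> * sin (\<Theta> t $ i) * A)
      (at t within {0..})" for i
    using sol t unfolding winfree_inertia_solution_def by metis
  show "((\<lambda>s. mean (\<Theta> s)) has_real_derivative mean (\<Omega> t)) (at t within {0..})"
    unfolding mean_def by (intro DERIV_cdivide DERIV_sum theta)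
  have "((\<lambda>s. mean (\<Omega> s)) has_real_derivative
      (\<Sum>i\<in>UNIV. - \<gamma> * \<Omega> t $ i + \<nu> $ i - \<kappa> * sin (\<Theta> t $ i) * A) / real CARD('n)) (at t within {0..})"
    unfolding mean_def by (intro DERIV_cdivide DERIV_sum omega)
  also have "(\<Sum>i\<in>UNIV. - \<gamma> * \<Omega> t $ i + \<nu> $ i - \<kappa> * sin (\<Theta> t $ i) * A) / real CARD('n) =
      - \<gamma> * mean (\<Omega> t) + mean \<nu> - \<kappa> * (S * A)"
    unfolding S_def mean_def
    by (simp add: sum.distrib sum_subtractf sum_negf diff_divide_distrib add_divide_distrib
        sum_distrib_left sum_distrib_right mult.assoc)
  finally show "((\<lambda>s. mean (\<Omega> s)) has_real_derivative - \<gamma> * mean (\<Omega> t) + mean \<nu> - \<kappa> * (S * A))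
      (at t within {0..})" .
qed

section \<open>Bootstrap along a solution\<close>

theorem theorem2p6:
  fixes \<gamma> \<kappa> D :: real
    and \<nu> \<Theta>\<^sub>0 \<Omega>\<^sub>0 :: "real ^ 'n"
    and \<Theta> \<Omega> :: "real \<Rightarrow> real ^ 'n"
  assumes "\<gamma> > 0" and "\<kappa> > 0" and "D > 0"
    and "0 < mean \<nu> - 2 * \<kappa>"
    and "mean \<nu> - 2 * \<kappa> \<le> \<gamma> * mean \<Omega>\<^sub>0"
    and "\<gamma> * mean \<Omega>\<^sub>0 \<le> mean \<nu> + 2 * \<kappa>"
    and "2 * pi * R_const \<kappa> \<nu> * alpha \<gamma> \<kappa> \<nu> \<Omega>\<^sub>0 D < \<gamma> * D"
    and "spread \<Theta>\<^sub>0 < D"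
    and "spread (\<Omega>\<^sub>0 + \<gamma> *\<^sub>R \<Theta>\<^sub>0) \<le> 2 * pi * L_const \<kappa> \<nu> * alpha \<gamma> \<kappa> \<nu> \<Omega>\<^sub>0 D"
    and "winfree_inertia_solution \<gamma> \<kappa> \<nu> \<Theta> \<Omega>"
    and "\<Theta> 0 = \<Theta>\<^sub>0" and "\<Omega> 0 = \<Omega>\<^sub>0"
  shows "bdd_above ((\<lambda>t. spread (\<Theta> t)) ` {0..}) \<and> (SUP t\<in>{0..}. spread (\<Theta> t)) \<le> D"
proof -
  note gpos = assms(1) and kpos = assms(2) and Dpos = assms(3)
  have nuc: "0 < mean \<nu>" using assms(2,4) by linarith
  define m0 where "m0 = m\<^sub>0 \<gamma> \<kappa> \<nu> \<Omega>\<^sub>0 D"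
  define \<alpha> where "\<alpha> = alpha \<gamma> \<kappa> \<nu> \<Omega>\<^sub>0 D"
  define k where "k = \<kappa> / mean \<nu>"
  define a where "a = \<alpha> / (k * \<gamma>)"
  \<comment> \<open>In units of \<open>\<kappa> / \<gamma>\<close>, \<open>d\<close> bounds the
    forcing of \<open>p\<close>; \<open>m\<close> will bound the velocity part of \<open>p\<close>,
    and \<open>h\<close> the distance from mean phase to slow phase.\<close>
  define d where "d = spread \<nu> / \<kappa>"
  define m where "m = m0 / \<gamma>"
  define h where "h = 2 * \<kappa> / \<gamma>\<^sup>2"
  have k: "0 < k" "k \<le> 1 / 2" and kappa: "\<kappa> = k * mean \<nu>"
    using nuc assms(2,4) by (auto simp: k_def field_simps)
  have m0: "spread \<Omega>\<^sub>0 \<le> m0" "spread \<nu> + 2 * \<kappa> * D \<le> \<gamma> * m0"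
    using gpos by (auto simp: m0_def m\<^sub>0_def max_def field_simps)
  have m0_nonneg: "0 \<le> m0" using m0(1) spread_nonneg[of \<Omega>\<^sub>0] by linarith
  have m: "0 \<le> m" using m0_nonneg gpos by (simp add: m_def)
  have d: "0 \<le> d" using kpos spread_nonneg[of \<nu>] by (simp add: d_def)
  have h: "h * D \<le> m"
    using m0(2) spread_nonneg[of \<nu>] gpos
    by (simp add: h_def m_def field_simps power2_eq_square)
  have \<alpha>: "(\<gamma> * spread \<nu> + 2 * \<kappa> * m0 + 3 * \<gamma> * \<kappa> * D\<^sup>2) / mean \<nu> \<le> \<alpha>"
    unfolding \<alpha>_def alpha_def m0_def[symmetric]
    using gpos kpos Dpos nuc assms(4) m0_nonneg spread_nonneg[of \<nu>] by simp
  have a1: "d + 2 * m + 3 * D\<^sup>2 \<le> a"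
  proof -
    have "d + 2 * m + 3 * D\<^sup>2 = (\<gamma> * spread \<nu> + 2 * \<kappa> * m0 + 3 * \<gamma> * \<kappa> * D\<^sup>2) / mean \<nu> / (k * \<gamma>)"
      using gpos kpos nuc by (simp add: d_def m_def k_def field_simps)
    also have "\<dots> \<le> a" unfolding a_def using \<alpha> k gpos by (intro divide_right_mono) auto
    finally show ?thesis .
  qed
  have "0 < D\<^sup>2" using Dpos by simp
  then have a_pos: "0 < a" "0 \<le> a - 2 * m" "3 * D\<^sup>2 \<le> a" using a1 d m by linarith+
  \<comment> \<open>The top of the barrier's range; the hypothesis on \<open>R\<close> puts it
    strictly below \<open>D\<close>.\<close>
  define K where "K = (2 + 4 * k + 3 * k\<^sup>2) * a"
  have K: "K < D"
  proof -
    have "K \<le> 2 * pi * k * R_const \<kappa> \<nu> * a"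
      unfolding K_def using R_const_lower[OF k k_def] a_pos by (intro mult_right_mono) auto
    also have "\<dots> = 2 * pi * R_const \<kappa> \<nu> * \<alpha> / \<gamma>" using k gpos by (simp add: a_def)
    also have "\<dots> < D" using assms(7) gpos unfolding \<alpha>_def[symmetric] by (simp add: field_simps)
    finally show ?thesis .
  qed
  have a2: "(2 + 4 * k) * a \<le> D"
  proof -
    have "(2 + 4 * k) * a \<le> K" unfolding K_def using a_pos by (intro mult_right_mono) auto
    with K show ?thesis by linarith
  qed
  have D6: "D \<le> 1 / 6"
  proof -
    have "2 * a \<le> (2 + 4 * k) * a" using k a_pos by (intro mult_right_mono) auto
    then have "2 * a \<le> D" using a2 by linarith
    then have "6 * D * D \<le> 1 * D" using a_pos(3) unfolding power2_eq_square by linarith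
    then show ?thesis using Dpos by (simp add: mult_le_cancel_right)
  qed
  define Q where "Q = (\<lambda>\<theta>. (a - 2 * m) * barrier rd sd k \<theta> + 2 * m * barrier rm sm k \<theta>)"
  define J where "J = (\<lambda>\<theta>. (a - 2 * m) * slope rd sd k \<theta> + 2 * m * slope rm sm k \<theta>)"
  have Q_upper: "Q \<theta> \<le> K" for \<theta>
  proof -
    have "Q \<theta> \<le> (a - 2 * m) * (2 + 4 * k + 3 * k\<^sup>2) + 2 * m * (2 + 4 * k + 3 * k\<^sup>2)"
      unfolding Q_def using barrier_bounds(2)[OF k] a_pos m by (intro add_mono mult_left_mono) auto
    then show ?thesis by (simp add: K_def algebra_simps)
  qed
  have Q_lower: "(2 - 4 * k + 4 * k\<^sup>2) * a \<le> Q \<theta>" for \<theta>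
  proof -
    have "(a - 2 * m) * (2 - 4 * k + 4 * k\<^sup>2) + 2 * m * (2 - 4 * k + 4 * k\<^sup>2) \<le> Q \<theta>"
      unfolding Q_def using barrier_bounds(1)[OF k] a_pos m by (intro add_mono mult_left_mono) auto
    then show ?thesis by (simp add: algebra_simps)
  qed
  have Q_deriv: "(Q has_real_derivative k * J \<theta>) (at \<theta>)" for \<theta>
    unfolding Q_def J_def
    by (auto intro!: derivative_eq_intros has_real_derivative_barrier simp: algebra_simps)

  define S where "S t = mean (\<chi> j. sin (\<Theta> t $ j))" for t
  define A where "A t = 1 + mean (\<chi> j. cos (\<Theta> t $ j))" for t
  note derivs = winfree_inertia_solution_derivatives[OF assms(10), folded S_def A_def]
  have A: "0 \<le> A t" "A t \<le> 2" for t
    using mean_bounds[of "\<chi> i. cos (\<Theta> t $ i)" 1] unfolding A_def by (auto simp: abs_le_iff)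
  have SA: "\<bar>S t * A t\<bar> \<le> 2" for t
  proof -
    have "\<bar>S t\<bar> \<le> 1" using mean_bounds[of "\<chi> i. sin (\<Theta> t $ i)" 1] unfolding S_def by simp
    then have "\<bar>S t\<bar> * \<bar>A t\<bar> \<le> 1 * 2" using A[of t] by (intro mult_mono) auto
    then show ?thesis by (simp add: abs_mult)
  qed

  \<comment> \<open>The force on the mean is at most \<open>2 \<kappa>\<close> in modulus, so the
    initial interval for \<open>\<gamma> \<omega>^c\<close> is invariant; each end is a linear
    inequality, for \<open>y\<close> and for \<open>- y\<close>.\<close>
  have speed: "\<bar>\<gamma> * mean (\<Omega> t) - mean \<nu>\<bar> \<le> 2 * \<kappa>" if "0 \<le> t" for t
  proof -
    have SA': "\<bar>\<kappa> * (S s * A s)\<bar> \<le> 2 * \<kappa>" for s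
      using SA[of s] kpos by (simp add: abs_mult)
    define y where "y = (\<lambda>s. \<gamma> * mean (\<Omega> s) - mean \<nu>)"
    define y' where "y' s = \<gamma> * (- \<gamma> * mean (\<Omega> s) + mean \<nu> - \<kappa> * (S s * A s))" for s
    have y': "(y has_real_derivative y' s) (at s within {0..})" if "0 \<le> s" for s
      unfolding y_def y'_def using derivs(4)[OF that] by (auto intro!: derivative_eq_intros)
    have "y t \<le> 2 * \<kappa>"
    proof (rule linear_ode_upper_bound[OF y'])
      fix s
      have "- \<gamma> * mean (\<Omega> s) + mean \<nu> - \<kappa> * (S s * A s) \<le> 2 * \<kappa> - y s"
        using SA'[of s] unfolding y_def by (simp add: abs_le_iff)
      then show "y' s \<le> \<gamma> * (2 * \<kappa> - y s)"
        unfolding y'_def using gpos by (intro mult_left_mono) auto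
    qed (use assms(6,12) that in \<open>auto simp: y_def\<close>)
    moreover have "- y t \<le> 2 * \<kappa>"
    proof (rule linear_ode_upper_bound[OF DERIV_minus[OF y']])
      fix s
      have "- (- \<gamma> * mean (\<Omega> s) + mean \<nu> - \<kappa> * (S s * A s)) \<le> 2 * \<kappa> - - y s"
        using SA'[of s] unfolding y_def by (simp add: abs_le_iff)
      then have "\<gamma> * - (- \<gamma> * mean (\<Omega> s) + mean \<nu> - \<kappa> * (S s * A s)) \<le> \<gamma> * (2 * \<kappa> - - y s)"
        using gpos by (intro mult_left_mono) auto
      then show "- y' s \<le> \<gamma> * (2 * \<kappa> - - y s)"
        unfolding y'_def mult_minus_right .
    qed (use assms(5,12) that in \<open>auto simp: y_def\<close>)
    ultimately show ?thesis by (simp add: y_def abs_le_iff)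
  qed

  \<comment> \<open>While phases differ by at most \<open>D\<close>, the forcing is at most
    \<open>spread \<nu> + 2 \<kappa> D \<le> \<gamma> m0\<close>, so the velocity differences cannot
    exceed \<open>m0\<close>.\<close>
  have omega_diff: "\<Omega> T $ i - \<Omega> T $ j \<le> m0"
    if T: "0 \<le> T" and bound: "\<And>t i j. 0 \<le> t \<Longrightarrow> t \<le> T \<Longrightarrow> \<Theta> t $ i - \<Theta> t $ j \<le> D" for T i j
  proof -
    define y' where "y' t = (- \<gamma> * \<Omega> t $ i + \<nu> $ i - \<kappa> * sin (\<Theta> t $ i) * A t)
        - (- \<gamma> * \<Omega> t $ j + \<nu> $ j - \<kappa> * sin (\<Theta> t $ j) * A t)" for t
    show ?thesis
    proof (rule linear_ode_upper_bound[of "\<lambda>t. \<Omega> t $ i - \<Omega> t $ j" y' T \<gamma>])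
      fix t assume t: "0 < t" "t < T"
      have "\<bar>sin (\<Theta> t $ i) - sin (\<Theta> t $ j)\<bar> \<le> \<bar>\<Theta> t $ i - \<Theta> t $ j\<bar>" by (rule abs_sin_diff_le)
      also have "\<dots> \<le> D" using bound[of t i j] bound[of t j i] t by auto
      finally have "\<bar>sin (\<Theta> t $ i) - sin (\<Theta> t $ j)\<bar> * A t \<le> D * 2"
        using A[of t] Dpos by (intro mult_mono) auto
      moreover have "- (sin (\<Theta> t $ i) - sin (\<Theta> t $ j)) * A t \<le> \<bar>sin (\<Theta> t $ i) - sin (\<Theta> t $ j)\<bar> * A t"
        using A[of t] by (intro mult_right_mono) auto
      ultimately have "\<kappa> * (- (sin (\<Theta> t $ i) - sin (\<Theta> t $ j)) * A t) \<le> \<kappa> * (2 * D)"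
        using kpos by (intro mult_left_mono) auto
      then show "y' t \<le> \<gamma> * (m0 - (\<Omega> t $ i - \<Omega> t $ j))"
        using m0(2) spread_ge[of \<nu> i j] unfolding y'_def by (simp add: algebra_simps)
    next
      fix t :: real assume "0 \<le> t"
      then show "((\<lambda>t. \<Omega> t $ i - \<Omega> t $ j) has_real_derivative y' t) (at t within {0..})"
        unfolding y'_def by (intro DERIV_diff derivs(2))
    qed (use T m0(1) spread_ge[of \<Omega>\<^sub>0 i j] assms(12) in auto)
  qed

  \<comment> \<open>The added velocity term cancels the damping: the derivative no longer contains
    \<omega>^c and is positive because \<open>\<nu>^c > 2 \<kappa>\<close>.\<close>
  define phase where "phase t = mean (\<Theta> t) + (mean (\<Omega> t) - mean \<nu> / \<gamma>) / \<gamma>" for t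
  have phase_deriv: "(phase has_real_derivative (mean \<nu> - \<kappa> * (S t * A t)) / \<gamma>) (at t within {0..})"
    if "0 \<le> t" for t
    unfolding phase_def[abs_def] using derivs(3,4)[OF that] gpos
    by (auto intro!: derivative_eq_intros simp: field_simps)
  have phase_near: "\<bar>mean (\<Theta> t) - phase t\<bar> \<le> h" if "0 \<le> t" for t
  proof -
    have "mean (\<Theta> t) - phase t = - ((\<gamma> * mean (\<Omega> t) - mean \<nu>) / \<gamma>\<^sup>2)"
      using gpos by (simp add: phase_def field_simps power2_eq_square)
    then have "\<bar>mean (\<Theta> t) - phase t\<bar> = \<bar>\<gamma> * mean (\<Omega> t) - mean \<nu>\<bar> / \<gamma>\<^sup>2" by simp
    also have "\<dots> \<le> h" unfolding h_def using speed[OF that] by (intro divide_right_mono) auto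
    finally show ?thesis .
  qed

  have below_barrier: "(\<Omega> T $ i - \<Omega> T $ j) / \<gamma> + (\<Theta> T $ i - \<Theta> T $ j) < Q (phase T)"
    if T: "0 \<le> T" and bound: "\<And>t i j. 0 \<le> t \<Longrightarrow> t \<le> T \<Longrightarrow> \<Theta> t $ i - \<Theta> t $ j \<le> D" for T i j
  proof -
    define p where "p t = (\<Omega> t $ i - \<Omega> t $ j) / \<gamma> + (\<Theta> t $ i - \<Theta> t $ j)" for t
    define G where "G t = (\<nu> $ i - \<nu> $ j) / \<kappa> - (sin (\<Theta> t $ i) - sin (\<Theta> t $ j)) * A t" for t
    have p: "(p has_real_derivative \<kappa> / \<gamma> * G t) (at t within {0..})" if "0 \<le> t" for t
      unfolding p_def[abs_def] using derivs(1,2)[OF that] gpos kpos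
      by (auto intro!: derivative_eq_intros simp: G_def field_simps)
    have q: "((\<lambda>t. Q (phase t)) has_real_derivative \<kappa> / \<gamma> * ((1 - k * (S t * A t)) * J (phase t))) (at t within {0..})"
      if "0 \<le> t" for t
    proof -
      have chain: "k * J (phase t) * ((mean \<nu> - \<kappa> * (S t * A t)) / \<gamma>) =
          \<kappa> / \<gamma> * ((1 - k * (S t * A t)) * J (phase t))"
        unfolding kappa using gpos by (simp add: field_simps)
      show ?thesis
        using DERIV_chain2[OF Q_deriv phase_deriv[OF that]] unfolding chain .
    qed
    have "0 < Q (phase T) - p T"
    proof (rule positive_if_increasing_at_zeros[of "\<lambda>t. Q (phase t) - p t"])
      fix t :: real assume t: "0 \<le> t"
      show "((\<lambda>t. Q (phase t) - p t) has_real_derivative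
          \<kappa> / \<gamma> * ((1 - k * (S t * A t)) * J (phase t)) - \<kappa> / \<gamma> * G t) (at t within {0..})"
        by (intro DERIV_diff p q t)
    next
      fix t assume t: "0 < t" "t \<le> T" and zero: "Q (phase t) - p t = 0"
      have pair: "\<Theta> t $ i - \<Theta> t $ j \<le> D" for i j using bound t by simp
      have omega: "\<Omega> t $ i - \<Omega> t $ j \<le> m0" for i j using omega_diff bound t by simp
      let ?u = "\<Theta> t $ i - \<Theta> t $ j" and ?v = "(\<Omega> t $ i - \<Omega> t $ j) / \<gamma>"
      let ?E = "trig_eval coupling (mean (\<Theta> t)) * ?u - (sin (\<Theta> t $ i) - sin (\<Theta> t $ j)) * A t"
      have "G t \<le> d - (sin (\<Theta> t $ i) - sin (\<Theta> t $ j)) * A t"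
        using spread_ge[of \<nu> i j] kpos unfolding G_def d_def by (simp add: divide_right_mono)
      also have "\<dots> = d - trig_eval coupling (mean (\<Theta> t)) * ?u + ?E" by simp
      also have "\<dots> < (1 - k * (S t * A t)) * J (phase t)"
        unfolding J_def
      proof (rule barrier_strict_growth[OF k Dpos m h a1 a2 d])
        show "\<bar>mean (\<Theta> t) - phase t\<bar> \<le> h" using phase_near t by simp
        show "\<bar>S t * A t - trig_eval drift (mean (\<Theta> t))\<bar> \<le> 3 / 2 * D\<^sup>2"
          unfolding S_def A_def by (rule mean_field_estimates(1)[OF pair Dpos D6])
        show "\<bar>?u\<bar> \<le> D" using pair[of i j] pair[of j i] by simp
        have "\<bar>\<Omega> t $ i - \<Omega> t $ j\<bar> \<le> m0" using omega[of i j] omega[of j i] by simp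
        then show "\<bar>?v\<bar> \<le> m" using gpos by (simp add: m_def divide_right_mono)
        show "?u + ?v = (a - 2 * m) * barrier rd sd k (phase t) + 2 * m * barrier rm sm k (phase t)"
          using zero by (simp add: p_def Q_def)
        show "?E \<le> 21 / 10 * D\<^sup>2"
          unfolding A_def by (rule mean_field_estimates(2)[OF pair Dpos D6])
      qed
      finally have "G t < (1 - k * (S t * A t)) * J (phase t)" .
      then have "\<kappa> / \<gamma> * G t < \<kappa> / \<gamma> * ((1 - k * (S t * A t)) * J (phase t))"
        using kpos gpos by (intro mult_strict_left_mono) auto
      then show "0 < \<kappa> / \<gamma> * ((1 - k * (S t * A t)) * J (phase t)) - \<kappa> / \<gamma> * G t" by simp
    next
      \<comment> \<open>The initial slow phase is arbitrary, so \<open>p 0\<close> is compared with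
        the bottom of the barrier's range.\<close>
      have "\<gamma> * p 0 = (\<Omega>\<^sub>0 + \<gamma> *\<^sub>R \<Theta>\<^sub>0) $ i - (\<Omega>\<^sub>0 + \<gamma> *\<^sub>R \<Theta>\<^sub>0) $ j"
        using gpos assms(11,12) by (simp add: p_def field_simps)
      also have "\<dots> \<le> 2 * pi * L_const \<kappa> \<nu> * \<alpha>"
        using spread_ge assms(9) unfolding \<alpha>_def by (rule order_trans)
      also have "\<dots> = \<gamma> * (2 * pi * k * L_const \<kappa> \<nu> * a)" using k gpos by (simp add: a_def)
      finally have "p 0 \<le> 2 * pi * k * L_const \<kappa> \<nu> * a" using gpos by simp
      also have "\<dots> < (2 - 4 * k + 4 * k\<^sup>2) * a"
        using L_const_upper[OF k k_def] a_pos by (intro mult_strict_right_mono) auto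
      also have "\<dots> \<le> Q (phase 0)" by (rule Q_lower)
      finally show "0 < Q (phase 0) - p 0" by simp
    qed (rule T)
    then show ?thesis by (simp add: p_def)
  qed

  have cont: "continuous_on {0..} (\<lambda>t. \<Theta> t $ i - \<Theta> t $ j)" for i j
    using derivs(1) by (intro continuous_on_diff DERIV_continuous_on) auto
  have diff_less: "\<Theta> t $ i - \<Theta> t $ j < D" if "0 \<le> t" for t i j
  proof (rule ccontr)
    assume large: "\<not> ?thesis"
    \<comment> \<open>All pairs are collected because the barrier estimate needs the bound
      \<open>D\<close> for every pair. The set is closed, so its infimum is a first bad time, before
      which the estimate applies.\<close>
    define bad where "bad = (\<Union>i. \<Union>j. {0..} \<inter> (\<lambda>t. \<Theta> t $ i - \<Theta> t $ j) -` {D..})"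
    have "closed bad"
      unfolding bad_def by (intro closed_UN finite ballI continuous_closed_preimage cont) auto
    moreover have "t \<in> bad"
      unfolding bad_def using large that by (intro UN_I[of i] UN_I[of j]) auto
    moreover have bdd: "bdd_below bad" by (auto simp: bad_def bdd_below_def)
    ultimately have "Inf bad \<in> bad" using closed_contains_Inf by blast
    define T where "T = Inf bad"
    obtain i j where T: "0 \<le> T" "D \<le> \<Theta> T $ i - \<Theta> T $ j"
      using \<open>Inf bad \<in> bad\<close> by (auto simp: bad_def T_def)
    have before: "\<Theta> s $ i - \<Theta> s $ j \<le> D" if "0 \<le> s" "s < T" for s i j
    proof (rule ccontr)
      assume "\<not> \<Theta> s $ i - \<Theta> s $ j \<le> D"
      then have "s \<in> bad"
        unfolding bad_def using that by (intro UN_I[of i] UN_I[of j]) auto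
      then have "T \<le> s" unfolding T_def using bdd by (rule cInf_lower)
      with that show False by simp
    qed
    \<comment> \<open>A difference may start above \<open>K\<close>; as it relaxes towards
      \<open>p < K\<close>, it stays below the larger of its initial value and \<open>K\<close>,
      both less than \<open>D\<close>.\<close>
    define B where "B = max (\<Theta>\<^sub>0 $ i - \<Theta>\<^sub>0 $ j) K"
    have "\<Theta> T $ i - \<Theta> T $ j \<le> B"
    proof (rule linear_ode_upper_bound[of "\<lambda>t. \<Theta> t $ i - \<Theta> t $ j" "\<lambda>t. \<Omega> t $ i - \<Omega> t $ j" T \<gamma>])
      fix s assume s: "0 < s" "s < T"
      have "(\<Omega> s $ i - \<Omega> s $ j) / \<gamma> + (\<Theta> s $ i - \<Theta> s $ j) < Q (phase s)"
        using s before by (intro below_barrier) auto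
      also have "\<dots> \<le> B" using Q_upper[of "phase s"] by (simp add: B_def)
      finally have "(\<Omega> s $ i - \<Omega> s $ j) / \<gamma> \<le> B - (\<Theta> s $ i - \<Theta> s $ j)" by simp
      then show "\<Omega> s $ i - \<Omega> s $ j \<le> \<gamma> * (B - (\<Theta> s $ i - \<Theta> s $ j))"
        using gpos by (simp add: pos_divide_le_eq mult.commute)
    next
      fix s :: real assume "0 \<le> s"
      then show "((\<lambda>t. \<Theta> t $ i - \<Theta> t $ j) has_real_derivative \<Omega> s $ i - \<Omega> s $ j) (at s within {0..})"
        by (intro DERIV_diff derivs(1))
    qed (use T assms(11) in \<open>auto simp: B_def\<close>)
    moreover have "B < D" using K spread_ge[of \<Theta>\<^sub>0 i j] assms(8) by (simp add: B_def)
    ultimately show False using T by linarith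
  qed
  have "spread (\<Theta> t) \<le> D" if "0 \<le> t" for t
    using diff_less[OF that] by (intro spread_le less_imp_le)
  then show ?thesis
    by (intro conjI cSUP_least bdd_aboveI[of _ D]) auto
qed

end
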